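(* Let $W(x)=e^{-x^2}Z(x)$, $x\in\mathbb{R}$, be an $N\times N$ Hermite-type weight matrix such that $W(x)=W(-x)$, and let $V(y)=y^{-1/2}W(\sqrt{y})=y^{-1/2}e^{-y}Z(\sqrt y)$, $y\in(0,\infty)$, be the associated Laguerre-type weight. For a differential operator $D$ in the variable $x$, let $\tilde D$ denote the differential operator in the variable $y=x^2$ determined by $(F\cdot D)(\sqrt{y})=(\tilde F\cdot\tilde D)(y)$ for all smooth matrix functions $F$, where $\tilde F(y)=F(\sqrt{y})$. Then: (i) if $D\in\mathcal{D}(W)$, then $\tilde D\in\mathcal{D}(V)$; (ii) if $D$ is $W$-symmetric, then $\tilde D$ is $V$-symmetric.
   Context: An $N\times N$ weight matrix on an interval $I$ is integrable, positive definite a.e., with exponential decay at infinity and finite moments; it defines $\langle P,Q\rangle_W=\int_I P(x)W(x)Q(x)^*dx$ and a unique sequence of monic orthogonal matrix polynomials $\{P_n\}_{n\ge0}$. Differential operators $D=\sum_{i=0}^s \frac{d^i}{dx^i}F_i(x)$ with matrix coefficients act on the right: $(P\cdot D)(x)=\sum_i P^{(i)}(x)F_i(x)$; compositions satisfy $P\cdot(D_1D_2)=(P\cdot D_1)\cdot D_2$. $\mathcal{D}(W)$ is the algebra of such operators with matrix polynomial coefficients for which there are constant matrices $\Lambda_n(D)$ with $P_n\cdot D=\Lambda_n(D)P_n$ for all $n\ge0$. An operator $D=\sum_i \frac{d^i}{dx^i}F_i(x)$ with $F_i$ matrix polynomials of degree $\le i$ is called $W$-symmetric if $\langle P\cdot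 D,Q\rangle_W=\langle P,Q\cdot D\rangle_W$ for all matrix polynomials $P,Q$; such operators belong to $\mathcal{D}(W)$. A Hermite-type weight is a weight on $\mathbb{R}$ of the form $e^{-x^2}Z(x)$; a Laguerre-type weight is a weight on $(0,\infty)$ of the form $y^\alpha e^{-y}Z(y)$, $\alpha>-1$. *)

theory Defs
  imports "HOL-Analysis.Analysis" "HOL-Computational_Algebra.Polynomial"
begin

definition madj :: "complex^'n^'n \<Rightarrow> complex^'n^'n" where
  "madj A = (\<chi> i j. cnj (A $ j $ i))"

definition pos_def_mat :: "complex^'n^'n \<Rightarrow> bool" where
  "pos_def_mat A \<longleftrightarrow> madj A = A \<and>
     (\<forall>v::complex^'n. v \<noteq> 0 \<longrightarrow> 0 < Re (\<Sum>i\<in>UNIV. cnj (v $ i) * (A *v v) $ i))"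

definition weight_matrix :: "real set \<Rightarrow> (real \<Rightarrow> complex^'n^'n) \<Rightarrow> bool" where
  "weight_matrix I W \<longleftrightarrow> is_interval I \<and>
     (\<forall>n i j. set_integrable lborel I (\<lambda>x. complex_of_real (x ^ n) * W x $ i $ j)) \<and>
     (AE x in lborel. x \<in> I \<longrightarrow> pos_def_mat (W x)) \<and>
     (\<exists>c>0. \<exists>C R. \<forall>x\<in>I. R \<le> \<bar>x\<bar> \<longrightarrow> (\<forall>i j. cmod (W x $ i $ j) \<le> C * exp (- c * \<bar>x\<bar>)))"

definition mip :: "real set \<Rightarrow> (real \<Rightarrow> complex^'n^'n) \<Rightarrow> (real \<Rightarrow> complex^'n^'n)
                     \<Rightarrow> (real \<Rightarrow> complex^'n^'n) \<Rightarrow> complex^'n^'n" where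
  "mip I W P Q = (\<chi> i j. set_lebesgue_integral lborel I (\<lambda>x. (P x ** W x ** madj (Q x)) $ i $ j))"

definition mpoly_deg_le :: "nat \<Rightarrow> (real \<Rightarrow> complex^'n^'n) \<Rightarrow> bool" where
  "mpoly_deg_le d P \<longleftrightarrow> (\<exists>p::'n \<Rightarrow> 'n \<Rightarrow> complex poly. (\<forall>i j. degree (p i j) \<le> d) \<and>
      (\<forall>x i j. P x $ i $ j = poly (p i j) (complex_of_real x)))"

definition is_mpoly :: "(real \<Rightarrow> complex^'n^'n) \<Rightarrow> bool" where
  "is_mpoly P \<longleftrightarrow> (\<exists>d. mpoly_deg_le d P)"

definition monic_mpoly :: "nat \<Rightarrow> (real \<Rightarrow> complex^'n^'n) \<Rightarrow> bool" where
  "monic_mpoly n P \<longleftrightarrow> (\<exists>p::'n \<Rightarrow> 'n \<Rightarrow> complex poly.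
      (\<forall>i j. degree (p i j) \<le> n \<and> coeff (p i j) n = (if i = j then 1 else 0)) \<and>
      (\<forall>x i j. P x $ i $ j = poly (p i j) (complex_of_real x)))"

definition monic_OPS :: "real set \<Rightarrow> (real \<Rightarrow> complex^'n^'n) \<Rightarrow> (nat \<Rightarrow> real \<Rightarrow> complex^'n^'n) \<Rightarrow> bool" where
  "monic_OPS I W P \<longleftrightarrow> (\<forall>n. monic_mpoly n (P n)) \<and>
      (\<forall>m n. m \<noteq> n \<longrightarrow> mip I W (P m) (P n) = 0)"

primrec mderiv :: "nat \<Rightarrow> (real \<Rightarrow> 'a::real_normed_vector) \<Rightarrow> real \<Rightarrow> 'a" where
  "mderiv 0 f = f"
| "mderiv (Suc k) f = (\<lambda>x. vector_derivative (mderiv k f) (at x))"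

text \<open>A differential operator D = sum_i d^i/dx^i F_i is given by the list [F_0,...,F_s];
  it acts on the right: (P . D)(x) = sum_i P^(i)(x) F_i(x).\<close>
definition dop_apply :: "(real \<Rightarrow> complex^'n^'n) list \<Rightarrow> (real \<Rightarrow> complex^'n^'n) \<Rightarrow> real \<Rightarrow> complex^'n^'n" where
  "dop_apply D P x = (\<Sum>i<length D. mderiv i P x ** (D ! i) x)"

definition poly_coeff_op :: "(real \<Rightarrow> complex^'n^'n) list \<Rightarrow> bool" where
  "poly_coeff_op D \<longleftrightarrow> (\<forall>i<length D. is_mpoly (D ! i))"

definition in_DW :: "real set \<Rightarrow> (real \<Rightarrow> complex^'n^'n) \<Rightarrow> (real \<Rightarrow> complex^'n^'n) list \<Rightarrow> bool" where
  "in_DW I W D \<longleftrightarrow> poly_coeff_op D \<and>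
     (\<forall>P. monic_OPS I W P \<longrightarrow> (\<exists>\<Lambda>::nat \<Rightarrow> complex^'n^'n. \<forall>n x. dop_apply D (P n) x = \<Lambda> n ** P n x))"

definition W_symmetric :: "real set \<Rightarrow> (real \<Rightarrow> complex^'n^'n) \<Rightarrow> (real \<Rightarrow> complex^'n^'n) list \<Rightarrow> bool" where
  "W_symmetric I W D \<longleftrightarrow> (\<forall>i<length D. mpoly_deg_le i (D ! i)) \<and>
     (\<forall>P Q. is_mpoly P \<longrightarrow> is_mpoly Q \<longrightarrow> mip I W (dop_apply D P) Q = mip I W P (dop_apply D Q))"

definition smooth_fun :: "(real \<Rightarrow> complex^'n^'n) \<Rightarrow> bool" where
  "smooth_fun F \<longleftrightarrow> (\<forall>k x. mderiv k F differentiable (at x))"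

definition tilde_op :: "(real \<Rightarrow> complex^'n^'n) list \<Rightarrow> (real \<Rightarrow> complex^'n^'n) list \<Rightarrow> bool" where
  "tilde_op D Dt \<longleftrightarrow> (\<forall>F. smooth_fun F \<longrightarrow>
     (\<forall>y>0. dop_apply D F (sqrt y) = dop_apply Dt (\<lambda>y. F (sqrt y)) y))"

end

theory Submission
  imports Defs
begin

text \<open>
  If \<open>P\<close> and \<open>S\<close> are the monic orthogonal sequences of \<open>V y\<close> and \<open>y V y\<close>, then \<open>P\<^sub>n (x\<^sup>2)\<close> and
  \<open>x S\<^sub>n (x\<^sup>2)\<close> together are orthogonal for the even weight \<open>W\<close>, because the substitution \<open>y = x\<^sup>2\<close>
  maps one inner product to the other and even and odd functions are orthogonal. An operator in
  \<open>\<D>(W)\<close> acts on this sequence by left multiplications and so preserves parity; hence the coefficient of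
  \<open>d\<^sup>i/dx\<^sup>i\<close> has the parity of \<open>i\<close>, and the chain rule turns the operator into one with coefficients
  polynomial in \<open>x\<^sup>2\<close>. Restricting to the even members gives (i). Symmetry transfers directly through
  the substitution, and the degree bound on the new coefficients follows from testing on monomials.
\<close>

text \<open>\<open>tilde_op\<close> describes an operator only by its action at
  \<open>y > 0\<close>, so the existence of a representative with polynomial coefficients has to be
  proved as well; this is where parity of the coefficients enters, since an operator mixing even and
  odd functions would leave odd powers of \<open>sqrt y\<close> behind. Membership in the algebra is
  a statement about all monic orthogonal sequences, so it gives information on \<open>D\<close> only
  once such a sequence is known to exist. Hence Gram-Schmidt is needed for both weights on the half
  line. The extra factor \<open>y\<close> in the second weight is the product of the two factors
  \<open>x\<close> in a pair of odd members. A \<open>W\<close>-symmetric operator gets its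
  representative through the algebra: symmetry and the degree bounds make every monic orthogonal
  polynomial an eigenfunction with a matrix eigenvalue. Identities obtained for \<open>y > 0\<close>
  extend to all reals because both sides are polynomials.\<close>

lemma matrix_mult_component: "(A ** B) $ i $ j = (\<Sum>k\<in>UNIV. A $ i $ k * B $ k $ j)"
  by (simp add: matrix_matrix_mult_def)

text \<open>Linearity in each factor suffices in finite dimension; boundedness then yields the
  algebraic rules below and lets left multiplication pass through derivatives.\<close>

lemma bounded_bilinear_matrix_mult:
  "bounded_bilinear ((**) :: complex^'n^'n \<Rightarrow> complex^'n^'n \<Rightarrow> complex^'n^'n)"
proof -
  have "linear ((**) A :: complex^'n^'n \<Rightarrow> complex^'n^'n)" for A :: "complex^'n^'n"
    by (intro linearI) (simp_all add: vec_eq_iff matrix_mult_component distrib_left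
        sum.distrib scaleR_sum_right)
  moreover have "linear (\<lambda>A :: complex^'n^'n. A ** B)" for B :: "complex^'n^'n"
    by (intro linearI) (simp_all add: vec_eq_iff matrix_mult_component distrib_right
        sum.distrib scaleR_sum_right)
  ultimately have "bilinear ((**) :: complex^'n^'n \<Rightarrow> complex^'n^'n \<Rightarrow> complex^'n^'n)"
    by (simp add: bilinear_def)
  then show ?thesis by (simp add: bilinear_conv_bounded_bilinear)
qed

lemmas mmul_add_left = bounded_bilinear.add_left[OF bounded_bilinear_matrix_mult]
  and mmul_add_right = bounded_bilinear.add_right[OF bounded_bilinear_matrix_mult]
  and mmul_diff_left = bounded_bilinear.diff_left[OF bounded_bilinear_matrix_mult]
  and mmul_zero_left = bounded_bilinear.zero_left[OF bounded_bilinear_matrix_mult]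
  and mmul_zero_right = bounded_bilinear.zero_right[OF bounded_bilinear_matrix_mult]
  and mmul_scaleR_left = bounded_bilinear.scaleR_left[OF bounded_bilinear_matrix_mult]
  and mmul_scaleR_right = bounded_bilinear.scaleR_right[OF bounded_bilinear_matrix_mult]
  and mmul_sum_left = bounded_bilinear.sum_left[OF bounded_bilinear_matrix_mult]
  and mmul_sum_right = bounded_bilinear.sum_right[OF bounded_bilinear_matrix_mult]
  and mmul_bounded_linear_right = bounded_bilinear.bounded_linear_right[OF bounded_bilinear_matrix_mult]

lemma linear_madj: "linear madj"
  by (intro linearI) (auto simp: madj_def vec_eq_iff)

lemma madj_component: "madj A $ i $ j = cnj (A $ j $ i)"
  by (simp add: madj_def)

lemma madj_madj: "madj (madj A) = A"
  by (simp add: madj_def vec_eq_iff)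

lemma madj_mult: "madj (A ** B) = madj B ** madj A"
  by (auto simp: vec_eq_iff madj_component matrix_mult_component mult.commute intro!: sum.cong)

lemma madj_mat_1: "madj (mat 1) = mat 1"
  by (auto simp: vec_eq_iff madj_component mat_def)

section \<open>Matrix polynomials\<close>

text \<open>The strict bound gives the zero polynomial its own level \<open>n = 0\<close>, where
  inductions on the degree start. Matrix coefficients replace the entrywise polynomials so that left
  multiplication and differentiation act termwise.\<close>

definition mpoly_deg_less :: "nat \<Rightarrow> (real \<Rightarrow> complex^'n^'n) \<Rightarrow> bool" where
  "mpoly_deg_less n P \<longleftrightarrow> (\<exists>A. \<forall>x. P x = (\<Sum>i<n. x ^ i *\<^sub>R A i))"

lemma mpoly_deg_lessI: "(\<And>x. P x = (\<Sum>i<n. x ^ i *\<^sub>R A i)) \<Longrightarrow> mpoly_deg_less n P"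
  by (auto simp: mpoly_deg_less_def)

lemma poly_of_real_eq_sum:
  fixes p :: "complex poly"
  assumes "degree p < n"
  shows "poly p (of_real x) = (\<Sum>i<n. x ^ i *\<^sub>R coeff p i)"
proof -
  have "poly p (of_real x) = (\<Sum>i\<le>degree p. coeff p i * of_real x ^ i)"
    by (rule poly_altdef)
  also have "\<dots> = (\<Sum>i<n. coeff p i * of_real x ^ i)"
    using assms by (intro sum.mono_neutral_left) (auto simp: coeff_eq_0)
  finally show ?thesis by (simp add: scaleR_conv_of_real mult.commute)
qed

lemma sum_eq_poly_of_real:
  fixes a :: "nat \<Rightarrow> complex"
  shows "(\<Sum>i\<le>n. x ^ i *\<^sub>R a i) = poly (\<Sum>i\<le>n. monom (a i) i) (of_real x)"
  by (simp add: poly_sum poly_monom scaleR_conv_of_real mult.commute)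

lemma degree_sum_monom_le: "degree (\<Sum>i\<le>n. monom (a i) i) \<le> n"
  by (rule degree_sum_le) (auto intro: order.trans[OF degree_monom_le])

lemma coeff_sum_monom: "k \<le> n \<Longrightarrow> coeff (\<Sum>i\<le>n. monom (a i) i) k = a k"
  by (simp add: coeff_sum)

lemma mpoly_deg_le_iff: "mpoly_deg_le d P \<longleftrightarrow> mpoly_deg_less (Suc d) P"
proof
  assume "mpoly_deg_le d P"
  then obtain p where p: "\<And>i j. degree (p i j) \<le> d" "\<And>x i j. P x $ i $ j = poly (p i j) (of_real x)"
    unfolding mpoly_deg_le_def by blast
  have "P x = (\<Sum>k<Suc d. x ^ k *\<^sub>R (\<chi> i j. coeff (p i j) k))" for x
    using p(1) by (simp add: vec_eq_iff p(2) poly_of_real_eq_sum[of _ "Suc d"] less_Suc_eq_le del: sum.lessThan_Suc)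
  then show "mpoly_deg_less (Suc d) P" by (rule mpoly_deg_lessI)
next
  assume "mpoly_deg_less (Suc d) P"
  then obtain A where A: "\<And>x. P x = (\<Sum>k\<le>d. x ^ k *\<^sub>R A k)"
    unfolding mpoly_deg_less_def lessThan_Suc_atMost by blast
  show "mpoly_deg_le d P" unfolding mpoly_deg_le_def
    by (intro exI[of _ "\<lambda>i j. \<Sum>k\<le>d. monom (A k $ i $ j) k"])
      (simp add: degree_sum_monom_le A flip: sum_eq_poly_of_real)
qed

lemma monic_mpoly_iff: "monic_mpoly n P \<longleftrightarrow> (\<exists>A. A n = mat 1 \<and> (\<forall>x. P x = (\<Sum>i<Suc n. x ^ i *\<^sub>R A i)))"
proof
  assume "monic_mpoly n P"
  then obtain p where p: "\<And>i j. degree (p i j) \<le> n" "\<And>i j. coeff (p i j) n = (if i = j then 1 else 0)"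
      "\<And>x i j. P x $ i $ j = poly (p i j) (of_real x)"
    unfolding monic_mpoly_def by blast
  have "P x = (\<Sum>k<Suc n. x ^ k *\<^sub>R (\<chi> i j. coeff (p i j) k))" for x
    using p(1) by (simp add: vec_eq_iff p(3) poly_of_real_eq_sum[of _ "Suc n"] less_Suc_eq_le del: sum.lessThan_Suc)
  moreover have "(\<chi> i j. coeff (p i j) n) = mat 1"
    by (simp add: p(2) mat_def)
  ultimately show "\<exists>A. A n = mat 1 \<and> (\<forall>x. P x = (\<Sum>i<Suc n. x ^ i *\<^sub>R A i))"
    by (intro exI[of _ "\<lambda>k. \<chi> i j. coeff (p i j) k"]) simp
next
  assume "\<exists>A. A n = mat 1 \<and> (\<forall>x. P x = (\<Sum>i<Suc n. x ^ i *\<^sub>R A i))"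
  then obtain A where A: "A n = mat 1" "\<And>x. P x = (\<Sum>k\<le>n. x ^ k *\<^sub>R A k)"
    unfolding lessThan_Suc_atMost by blast
  show "monic_mpoly n P" unfolding monic_mpoly_def
  proof (intro exI conjI allI)
    fix i j
    show "coeff (\<Sum>k\<le>n. monom (A k $ i $ j) k) n = (if i = j then 1 else 0)"
      by (subst coeff_sum_monom) (simp_all add: A(1) mat_def)
    show "P x $ i $ j = poly (\<Sum>k\<le>n. monom (A k $ i $ j) k) (of_real x)" for x
      by (subst sum_eq_poly_of_real[symmetric]) (simp add: A(2))
  qed (rule degree_sum_monom_le)
qed

lemma monic_mpoly_deg_less: "monic_mpoly n P \<Longrightarrow> mpoly_deg_less (Suc n) P"
  by (auto simp: monic_mpoly_iff mpoly_deg_less_def)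

lemma is_mpoly_iff: "is_mpoly P \<longleftrightarrow> (\<exists>n. mpoly_deg_less n P)"
proof
  assume "\<exists>n. mpoly_deg_less n P"
  then obtain n A where A: "\<And>x. P x = (\<Sum>i<n. x ^ i *\<^sub>R A i)" by (auto simp: mpoly_deg_less_def)
  have "mpoly_deg_less (Suc n) P"
    by (rule mpoly_deg_lessI[where A = "\<lambda>i. if i < n then A i else 0"]) (simp add: A)
  then show "is_mpoly P" by (auto simp: is_mpoly_def mpoly_deg_le_iff)
qed (auto simp: is_mpoly_def mpoly_deg_le_iff)

lemma is_mpolyI: "mpoly_deg_less n P \<Longrightarrow> is_mpoly P"
  by (auto simp: is_mpoly_iff)

lemma is_mpolyE: "is_mpoly P \<Longrightarrow> (\<And>n. mpoly_deg_less n P \<Longrightarrow> thesis) \<Longrightarrow> thesis"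
  by (auto simp: is_mpoly_iff)

lemma mpoly_deg_less_obtain:
  assumes "mpoly_deg_less n P" "n \<le> m"
  obtains A where "\<And>x. P x = (\<Sum>i<m. x ^ i *\<^sub>R A i)" "\<And>i. i \<ge> n \<Longrightarrow> A i = 0"
proof -
  obtain A where A: "\<And>x. P x = (\<Sum>i<n. x ^ i *\<^sub>R A i)" using assms by (auto simp: mpoly_deg_less_def)
  show ?thesis
  proof (rule that[of "\<lambda>i. if i < n then A i else 0"])
    show "P x = (\<Sum>i<m. x ^ i *\<^sub>R (if i < n then A i else 0))" for x
      unfolding A using assms(2) by (intro sum.mono_neutral_cong_left) auto
  qed auto
qed

lemma mpoly_deg_less_mono: "mpoly_deg_less n P \<Longrightarrow> n \<le> m \<Longrightarrow> mpoly_deg_less m P"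
  by (erule (1) mpoly_deg_less_obtain) (auto simp: mpoly_deg_less_def)

lemma mpoly_deg_less_0: "mpoly_deg_less 0 P \<longleftrightarrow> P = (\<lambda>x. 0)"
  by (auto simp: mpoly_deg_less_def)

lemma mpoly_deg_less_zero [simp]: "mpoly_deg_less n (\<lambda>x. 0)"
  by (rule mpoly_deg_lessI[where A = "\<lambda>i. 0"]) simp

lemma mpoly_deg_less_add:
  assumes "mpoly_deg_less n P" "mpoly_deg_less n Q"
  shows "mpoly_deg_less n (\<lambda>x. P x + Q x)"
proof -
  obtain A B where "\<And>x. P x = (\<Sum>i<n. x ^ i *\<^sub>R A i)" "\<And>x. Q x = (\<Sum>i<n. x ^ i *\<^sub>R B i)"
    using assms by (auto simp: mpoly_deg_less_def)
  then show ?thesis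
    by (intro mpoly_deg_lessI[where A = "\<lambda>i. A i + B i"]) (simp add: sum.distrib scaleR_add_right)
qed

lemma mpoly_deg_less_linear:
  assumes "mpoly_deg_less n P" "linear L"
  shows "mpoly_deg_less n (\<lambda>x. L (P x))"
proof -
  obtain A where "\<And>x. P x = (\<Sum>i<n. x ^ i *\<^sub>R A i)"
    using assms by (auto simp: mpoly_deg_less_def)
  then show ?thesis
    by (intro mpoly_deg_lessI[where A = "\<lambda>i. L (A i)"])
      (simp add: linear_sum[OF assms(2)] linear_scale[OF assms(2)])
qed

lemma mpoly_deg_less_mult_left: "mpoly_deg_less n P \<Longrightarrow> mpoly_deg_less n (\<lambda>x. A ** P x)"
  by (erule mpoly_deg_less_linear) (rule bounded_linear.linear[OF mmul_bounded_linear_right])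

lemma mpoly_deg_less_scaleR: "mpoly_deg_less n P \<Longrightarrow> mpoly_deg_less n (\<lambda>x. c *\<^sub>R P x)"
  by (erule mpoly_deg_less_linear) (rule linear_scaleR)

lemma mpoly_deg_less_diff:
  assumes "mpoly_deg_less n P" "mpoly_deg_less n Q"
  shows "mpoly_deg_less n (\<lambda>x. P x - Q x)"
  using mpoly_deg_less_add[OF assms(1) mpoly_deg_less_scaleR[OF assms(2), of "-1"]] by simp

lemma mpoly_deg_less_sum:
  "(\<And>i. i \<in> I \<Longrightarrow> mpoly_deg_less n (P i)) \<Longrightarrow> mpoly_deg_less n (\<lambda>x. \<Sum>i\<in>I. P i x)"
  by (induction I rule: infinite_finite_induct) (auto intro: mpoly_deg_less_add)

lemma mpoly_deg_less_power_scaleR: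
  assumes "mpoly_deg_less n P"
  shows "mpoly_deg_less (k + n) (\<lambda>x. x ^ k *\<^sub>R P x)"
proof -
  obtain A where A: "\<And>x. P x = (\<Sum>i<n. x ^ i *\<^sub>R A i)" using assms by (auto simp: mpoly_deg_less_def)
  show ?thesis
  proof (rule mpoly_deg_lessI[where A = "\<lambda>i. if i < k then 0 else A (i - k)"])
    fix x
    have "(\<Sum>i<k+n. x ^ i *\<^sub>R (if i < k then 0 else A (i - k))) = 
          (\<Sum>i=k..<k+n. x ^ i *\<^sub>R A (i - k))"
      by (intro sum.mono_neutral_cong_right) auto
    also have "\<dots> = (\<Sum>i=0..<n. x ^ (i + k) *\<^sub>R A i)"
      using sum.shift_bounds_nat_ivl[of "\<lambda>i. x ^ i *\<^sub>R A (i - k)" 0 k n] by (simp add: add.commute)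
    finally show "x ^ k *\<^sub>R P x = (\<Sum>i<k+n. x ^ i *\<^sub>R (if i < k then 0 else A (i - k)))"
      by (simp add: A scaleR_sum_right power_add mult.commute atLeast0LessThan)
  qed
qed

lemma mpoly_deg_less_const: "mpoly_deg_less (Suc 0) (\<lambda>x. A)"
  by (rule mpoly_deg_lessI[where A = "\<lambda>i. A"]) simp

lemma mpoly_deg_less_monomial: "mpoly_deg_less (Suc k) (\<lambda>x. x ^ k *\<^sub>R A)"
  using mpoly_deg_less_power_scaleR[OF mpoly_deg_less_const, of k A] by simp

lemma mpoly_deg_less_mult:
  assumes "mpoly_deg_less (Suc n) P" "mpoly_deg_less m Q"
  shows "mpoly_deg_less (n + m) (\<lambda>x. P x ** Q x)"
proof -
  obtain A where A: "\<And>x. P x = (\<Sum>i<Suc n. x ^ i *\<^sub>R A i)" using assms by (auto simp: mpoly_deg_less_def)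
  have "mpoly_deg_less (n + m) (\<lambda>x. \<Sum>i<Suc n. x ^ i *\<^sub>R (A i ** Q x))"
    by (intro mpoly_deg_less_sum mpoly_deg_less_mono[OF mpoly_deg_less_power_scaleR,
        OF mpoly_deg_less_mult_left, OF assms(2)]) auto
  then show ?thesis by (simp only: A mmul_sum_left mmul_scaleR_left)
qed

lemma mpoly_deg_less_compose_minus:
  assumes "mpoly_deg_less n P"
  shows "mpoly_deg_less n (\<lambda>x. P (- x))"
proof -
  obtain A where A: "\<And>x. P x = (\<Sum>i<n. x ^ i *\<^sub>R A i)" using assms by (auto simp: mpoly_deg_less_def)
  have "P (- x) = (\<Sum>i<n. x ^ i *\<^sub>R ((-1) ^ i *\<^sub>R A i))" for x
    unfolding A power_minus[of x] by (simp add: mult.commute)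
  then show ?thesis by (rule mpoly_deg_lessI)
qed

lemma mpoly_deg_less_compose_square:
  assumes "mpoly_deg_less (Suc n) P"
  shows "mpoly_deg_less (Suc (2 * n)) (\<lambda>x. P (x\<^sup>2))"
proof -
  obtain A where A: "\<And>x. P x = (\<Sum>i<Suc n. x ^ i *\<^sub>R A i)" using assms by (auto simp: mpoly_deg_less_def)
  have "mpoly_deg_less (Suc (2 * n)) (\<lambda>x. \<Sum>i<Suc n. x ^ (2*i) *\<^sub>R A i)"
    by (intro mpoly_deg_less_sum mpoly_deg_less_mono[OF mpoly_deg_less_monomial]) auto
  then show ?thesis by (simp only: A power_mult)
qed

lemma is_mpoly_add: "is_mpoly P \<Longrightarrow> is_mpoly Q \<Longrightarrow> is_mpoly (\<lambda>x. P x + Q x)"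
proof -
  assume "is_mpoly P" "is_mpoly Q"
  then obtain n m where "mpoly_deg_less n P" "mpoly_deg_less m Q" by (auto simp: is_mpoly_iff)
  then show ?thesis unfolding is_mpoly_iff
    by (intro exI[of _ "max n m"] mpoly_deg_less_add) (erule mpoly_deg_less_mono, simp)+
qed

lemma is_mpoly_zero [simp]: "is_mpoly (\<lambda>x. 0)"
  using mpoly_deg_less_zero by (auto simp: is_mpoly_iff)

lemma is_mpoly_sum: "(\<And>i. i \<in> I \<Longrightarrow> is_mpoly (P i)) \<Longrightarrow> is_mpoly (\<lambda>x. \<Sum>i\<in>I. P i x)"
  by (induction I rule: infinite_finite_induct) (auto intro: is_mpoly_add)

lemma is_mpoly_mult: "is_mpoly P \<Longrightarrow> is_mpoly Q \<Longrightarrow> is_mpoly (\<lambda>x. P x ** Q x)"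
  by (elim is_mpolyE) (rule is_mpolyI, rule mpoly_deg_less_mult,
      erule mpoly_deg_less_mono, rule le_SucI, rule order_refl)

lemma is_mpoly_compose_square: "is_mpoly P \<Longrightarrow> is_mpoly (\<lambda>x. P (x\<^sup>2))"
  by (elim is_mpolyE) (rule is_mpolyI, rule mpoly_deg_less_compose_square,
      erule mpoly_deg_less_mono, rule le_SucI, rule order_refl)

lemma is_mpoly_compose_minus: "is_mpoly P \<Longrightarrow> is_mpoly (\<lambda>x. P (- x))"
  by (elim is_mpolyE) (rule is_mpolyI, erule mpoly_deg_less_compose_minus)

lemma is_mpoly_const_mult: "is_mpoly P \<Longrightarrow> is_mpoly (\<lambda>x. A ** P x)"
  by (elim is_mpolyE) (rule is_mpolyI, erule mpoly_deg_less_mult_left)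

lemma is_mpoly_scaleR: "is_mpoly P \<Longrightarrow> is_mpoly (\<lambda>x. c *\<^sub>R P x)"
  by (elim is_mpolyE) (rule is_mpolyI, erule mpoly_deg_less_scaleR)

lemma is_mpoly_power_scaleR: "is_mpoly P \<Longrightarrow> is_mpoly (\<lambda>x. x ^ k *\<^sub>R P x)"
  by (elim is_mpolyE) (rule is_mpolyI, erule mpoly_deg_less_power_scaleR)

lemma is_mpoly_monomial: "is_mpoly (\<lambda>x. x ^ k *\<^sub>R A)"
  by (rule is_mpolyI, rule mpoly_deg_less_monomial)

text \<open>A nonzero polynomial has finitely many complex roots, and the real roots embed
  injectively among them. Applied entrywise, this handles matrix and vector polynomials.\<close>

lemma real_poly_coeffs_eq_zero:
  fixes a :: "nat \<Rightarrow> complex"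
  assumes "infinite {x::real. (\<Sum>i<n. x ^ i *\<^sub>R a i) = 0}" "i < n"
  shows "a i = 0"
proof (rule ccontr)
  assume "a i \<noteq> 0"
  then have "finite {z. (\<Sum>i\<le>n-1. a i * z ^ i) = 0}"
    using assms(2) by (intro polyfun_rootbound_finite exI[of _ i]) auto
  moreover have "of_real ` {x::real. (\<Sum>i<n. x ^ i *\<^sub>R a i) = 0} \<subseteq> {z. (\<Sum>i\<le>n-1. a i * z ^ i) = 0}"
  proof -
    have "{..<n} = {..n-1}" using assms(2) by auto
    then show ?thesis by (auto simp: scaleR_conv_of_real mult.commute)
  qed
  ultimately have "finite (complex_of_real ` {x::real. (\<Sum>i<n. x ^ i *\<^sub>R a i) = 0})"
    by (rule finite_subset[rotated])
  then show False using assms(1) by (simp add: finite_image_iff inj_on_def)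
qed

lemma mpoly_coeffs_unique:
  fixes A B :: "nat \<Rightarrow> complex^'n^'n"
  assumes "\<And>x::real. x > 0 \<Longrightarrow> (\<Sum>i<n. x ^ i *\<^sub>R A i) = (\<Sum>i<n. x ^ i *\<^sub>R B i)" "i < n"
  shows "A i = B i"
proof -
  have "A i $ j $ k - B i $ j $ k = 0" for j k
  proof (rule real_poly_coeffs_eq_zero[where a = "\<lambda>i. A i $ j $ k - B i $ j $ k", OF _ assms(2)])
    have "(\<Sum>i<n. x ^ i *\<^sub>R (A i $ j $ k - B i $ j $ k)) = 0" if "x > 0" for x :: real
    proof -
      have "(\<Sum>i<n. x ^ i *\<^sub>R A i) $ j $ k = (\<Sum>i<n. x ^ i *\<^sub>R B i) $ j $ k" using assms(1)[OF that] by simp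
      then show ?thesis by (simp add: scaleR_diff_right sum_subtractf)
    qed
    then have "{0<..} \<subseteq> {x::real. (\<Sum>i<n. x ^ i *\<^sub>R (A i $ j $ k - B i $ j $ k)) = 0}" by auto
    then show "infinite \<dots>" by (rule infinite_super) (rule infinite_Ioi)
  qed
  then show ?thesis by (simp add: vec_eq_iff)
qed

text \<open>The substitution controls only positive arguments; this carries the resulting identities
  to the whole line.\<close>

lemma mpoly_eqI:
  assumes "is_mpoly P" "is_mpoly Q" "\<And>x. x > 0 \<Longrightarrow> P x = Q x"
  shows "P x = Q x"
proof -
  obtain n m where nm: "mpoly_deg_less n P" "mpoly_deg_less m Q"
    using assms(1,2) by (auto elim!: is_mpolyE)
  define k where "k = max n m"
  have "mpoly_deg_less k P" "mpoly_deg_less k Q"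
    using nm by (auto simp: k_def intro: mpoly_deg_less_mono)
  then obtain A B where A: "\<And>x. P x = (\<Sum>i<k. x ^ i *\<^sub>R A i)"
    and B: "\<And>x. Q x = (\<Sum>i<k. x ^ i *\<^sub>R B i)"
    by (auto simp: mpoly_deg_less_def)
  have "A i = B i" if "i < k" for i
    by (rule mpoly_coeffs_unique[OF _ that]) (use assms(3) in \<open>simp flip: A B\<close>)
  then show ?thesis by (auto simp: A B intro!: sum.cong)
qed

lemma sum_lessThan_double:
  fixes f :: "nat \<Rightarrow> 'a::comm_monoid_add"
  assumes "\<And>i. odd i \<Longrightarrow> f i = 0"
  shows "(\<Sum>i<2*n. f i) = (\<Sum>i<n. f (2 * i))"
  by (induction n) (auto simp: assms)

lemma even_mpoly_obtain:
  assumes "is_mpoly P" "\<And>x. P (- x) = P x"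
  obtains Q where "is_mpoly Q" "\<And>x. P x = Q (x\<^sup>2)"
proof -
  obtain n where "mpoly_deg_less n P" using assms by (auto simp: is_mpoly_iff)
  then obtain A where A: "\<And>x. P x = (\<Sum>i<2*n. x ^ i *\<^sub>R A i)"
    by (rule mpoly_deg_less_obtain[of n P "2*n"]) auto
  define Q where "Q = (\<lambda>y::real. \<Sum>i<n. y ^ i *\<^sub>R A (2 * i))"
  have "P x = Q (x\<^sup>2)" for x
  proof -
    \<comment> \<open>Averaging \<open>P x\<close> and \<open>P (- x)\<close> cancels the odd powers
      whatever their coefficients are, so no coefficients have to be compared.\<close>
    have "P x = (1/2) *\<^sub>R (P x + P (-x))" by (simp add: assms(2) flip: scaleR_2)
    also have "\<dots> = (1/2) *\<^sub>R (\<Sum>i<2*n. (x ^ i + (- x) ^ i) *\<^sub>R A i)"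
      by (simp only: A scaleR_left_distrib sum.distrib)
    also have "\<dots> = (\<Sum>i<2*n. if even i then x ^ i *\<^sub>R A i else 0)"
      unfolding scaleR_sum_right by (rule sum.cong) (auto simp: uminus_power_if)
    also have "\<dots> = Q (x\<^sup>2)" unfolding Q_def by (subst sum_lessThan_double) (auto simp: power_mult)
    finally show ?thesis .
  qed
  moreover have "is_mpoly Q" unfolding is_mpoly_iff Q_def by (intro exI mpoly_deg_lessI) (rule refl)
  ultimately show ?thesis using that by blast
qed

lemma mpoly_deg_less_of_square:
  assumes "is_mpoly P" "mpoly_deg_less (Suc (2 * n)) Q" "\<And>x. x > 0 \<Longrightarrow> P (x\<^sup>2) = Q x"
  shows "mpoly_deg_less (Suc n) P"
proof -
  obtain m0 where m0: "mpoly_deg_less m0 P" using assms by (auto simp: is_mpoly_iff)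
  \<comment> \<open>Both sides are padded to a common length so that coefficients can be compared:
    \<open>B\<close> vanishes beyond \<open>2 * n\<close>, and its even positions carry the
    coefficients of \<open>P\<close>.\<close>
  define m where "m = max m0 (Suc n)"
  have "mpoly_deg_less m P" using m0 by (rule mpoly_deg_less_mono) (simp add: m_def)
  then obtain A where A: "\<And>x. P x = (\<Sum>i<m. x ^ i *\<^sub>R A i)"
    by (auto simp: mpoly_deg_less_def)
  have "Suc n \<le> m" by (simp add: m_def)
  then have le: "Suc (2 * n) \<le> 2 * m" by linarith
  obtain B where B: "\<And>x. Q x = (\<Sum>i<2*m. x ^ i *\<^sub>R B i)" "\<And>i. i \<ge> Suc (2 * n) \<Longrightarrow> B i = 0"
    by (rule mpoly_deg_less_obtain[OF assms(2) le]) (rule that)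
  define C where "C = (\<lambda>i. if even i then A (i div 2) else 0)"
  have PC: "P (x\<^sup>2) = (\<Sum>i<2*m. x ^ i *\<^sub>R C i)" for x
    by (subst sum_lessThan_double) (simp_all add: C_def A power_mult)
  have BC: "B i = C i" if "i < 2 * m" for i
    by (rule mpoly_coeffs_unique[OF _ that]) (use assms(3) in \<open>simp flip: B(1) PC\<close>)
  have AB: "A i = B (2 * i)" if "i < m" for i 
    using BC[of "2 * i"] that by (simp add: C_def)
  have "A i = 0" if "i \<in> {..<m} - {..<Suc n}" for i
    using that by (simp add: AB B(2))
  then have "P x = (\<Sum>i<Suc n. x ^ i *\<^sub>R A i)" for x
    unfolding A using \<open>Suc n \<le> m\<close> by (intro sum.mono_neutral_right) auto
  then show ?thesis by (rule mpoly_deg_lessI)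
qed

text \<open>The leading coefficient of \<open>P\<close> is the identity, so the coefficient of
  \<open>x ^ n\<close> in \<open>Q\<close> can itself serve as \<open>B\<close>.\<close>

lemma monic_mpoly_division:
  assumes "monic_mpoly n P" "mpoly_deg_less (Suc n) Q"
  obtains B where "mpoly_deg_less n (\<lambda>x. Q x - B ** P x)"
proof -
  obtain A where A: "A n = mat 1" "\<And>x. P x = (\<Sum>i<Suc n. x ^ i *\<^sub>R A i)"
    using assms by (auto simp: monic_mpoly_iff)
  obtain B where B: "\<And>x. Q x = (\<Sum>i<Suc n. x ^ i *\<^sub>R B i)" 
    using assms by (auto simp: mpoly_deg_less_def)
  show ?thesis
    by (rule that[of "B n"], rule mpoly_deg_lessI[where A = "\<lambda>i. B i - B n ** A i"])
      (simp add: A B mmul_sum_right mmul_add_right mmul_scaleR_right scaleR_diff_right sum_subtractf)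
qed

text \<open>Repeated division shows that monic polynomials of all degrees below \<open>n\<close>
  generate from the left; multiplication is kept on that side because operators acting on the right
  commute with it.\<close>

lemma mpoly_induct_monic [consumes 2, case_names zero basis add]:
  assumes "\<And>k. k < n \<Longrightarrow> monic_mpoly k (P k)" "mpoly_deg_less n Q"
    and "Pr (\<lambda>x. 0)"
    and "\<And>k B. k < n \<Longrightarrow> Pr (\<lambda>x. B ** P k x)"
    and "\<And>Q R. mpoly_deg_less n Q \<Longrightarrow> mpoly_deg_less n R \<Longrightarrow> Pr Q \<Longrightarrow> Pr R \<Longrightarrow> Pr (\<lambda>x. Q x + R x)"
  shows "Pr Q"
proof -
  have "mpoly_deg_less k Q \<Longrightarrow> k \<le> n \<Longrightarrow> Pr Q" for k Q
  proof (induction k arbitrary: Q)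
    case 0
    then show ?case using assms(3) by (simp add: mpoly_deg_less_0)
  next
    case (Suc k)
    obtain B where B: "mpoly_deg_less k (\<lambda>x. Q x - B ** P k x)"
      using monic_mpoly_division[OF assms(1) Suc.prems(1)] Suc.prems(2) by auto
    have "Pr (\<lambda>x. (Q x - B ** P k x) + B ** P k x)"
    proof (rule assms(5))
      show "mpoly_deg_less n (\<lambda>x. Q x - B ** P k x)" using B by (rule mpoly_deg_less_mono) (use Suc in simp)
      show "mpoly_deg_less n (\<lambda>x. B ** P k x)" 
        by (rule mpoly_deg_less_mono[OF mpoly_deg_less_mult_left[OF monic_mpoly_deg_less[OF assms(1)]]])
          (use Suc in auto)
    qed (use Suc B assms(4) in auto)
    then show ?case by simp
  qed
  then show ?thesis using assms(2) by blast
qed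

section \<open>Iterated derivatives\<close>

text \<open>\<open>mderiv\<close> is formed from functions on the whole line, whereas a composite
  with \<open>sqrt\<close> is controlled only at positive arguments; locality of the derivative
  bridges this.\<close>

lemma mderiv_cong_open:
  assumes "open S" "\<And>x. x \<in> S \<Longrightarrow> f x = g x" "x \<in> S"
  shows "mderiv k f x = mderiv k g x"
  using assms(3)
proof (induction k arbitrary: x)
  case (Suc k)
  have "\<forall>\<^sub>F y in nhds x. y \<in> S \<longrightarrow> mderiv k f y = mderiv k g y"
    using Suc.IH by (intro always_eventually) blast
  moreover have "\<forall>\<^sub>F y in nhds x. y \<in> S" using assms(1) Suc.prems by (rule eventually_nhds_in_open)
  ultimately have "\<forall>\<^sub>F y in nhds x. mderiv k f y = mderiv k g y" by eventually_elim simp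
  then show ?case by (simp add: vector_derivative_cong_eq)
qed (simp add: assms)

lemma smooth_fun_deriv:
  "smooth_fun F \<Longrightarrow> (mderiv k F has_vector_derivative mderiv (Suc k) F x) (at x)"
  by (simp add: smooth_fun_def vector_derivative_works)

lemma smooth_funI:
  assumes "\<And>k. \<exists>G. \<forall>x. (mderiv k F has_vector_derivative G x) (at x)"
  shows "smooth_fun F"
  unfolding smooth_fun_def using assms differentiableI_vector by blast

lemma mderiv_linear:
  assumes "bounded_linear L" "smooth_fun F"
  shows "mderiv k (\<lambda>x. L (F x)) = (\<lambda>x. L (mderiv k F x))"
proof (induction k)
  case (Suc k)
  show ?case
    using bounded_linear.has_vector_derivative[OF assms(1) smooth_fun_deriv[OF assms(2)]]
    by (auto simp: Suc.IH fun_eq_iff vector_derivative_at)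
qed simp

lemma mderiv_add:
  assumes "smooth_fun F" "smooth_fun G"
  shows "mderiv k (\<lambda>x. F x + G x) = (\<lambda>x. mderiv k F x + mderiv k G x)"
proof (induction k)
  case (Suc k)
  show ?case
    using has_vector_derivative_add[OF smooth_fun_deriv[OF assms(1)] smooth_fun_deriv[OF assms(2)]]
    by (auto simp: Suc.IH fun_eq_iff vector_derivative_at)
qed simp

text \<open>Truncated subtraction makes a factor of the product zero as soon as
  \<open>k > n\<close>, so the formula also covers the vanishing derivatives.\<close>

lemma mderiv_power_scaleR:
  fixes A :: "'a::real_normed_vector"
  shows "mderiv k (\<lambda>x. (x - a) ^ n *\<^sub>R A) = (\<lambda>x. ((\<Prod>j<k. real (n - j)) * (x - a) ^ (n - k)) *\<^sub>R A)"
proof (induction k)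
  case (Suc k)
  have "((\<lambda>x. ((\<Prod>j<k. real (n - j)) * (x - a) ^ (n - k)) *\<^sub>R A) has_vector_derivative
      ((\<Prod>j<Suc k. real (n - j)) * (x - a) ^ (n - Suc k)) *\<^sub>R A) (at x)" for x
    by (auto intro!: derivative_eq_intros)
  then show ?case unfolding mderiv.simps Suc.IH by (intro ext vector_derivative_at)
qed simp

lemma mderiv_power_scaleR_at_root:
  "mderiv k (\<lambda>x. (x - a) ^ n *\<^sub>R A) a = (if k = n then fact n *\<^sub>R A else 0)"
proof (cases k n rule: linorder_cases)
  case equal
  have "(\<Prod>j<n. real (n - j)) = fact n"
    unfolding fact_prod_rev by (simp add: atLeast0LessThan)
  then show ?thesis using equal by (simp add: mderiv_power_scaleR)
qed (auto simp: mderiv_power_scaleR)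

lemma mpoly_has_vector_derivative:
  assumes "mpoly_deg_less n P"
  obtains P' where "mpoly_deg_less (n - 1) P'" "\<And>x. (P has_vector_derivative P' x) (at x)"
proof -
  obtain A where A: "\<And>x. P x = (\<Sum>i<n. x ^ i *\<^sub>R A i)" using assms by (auto simp: mpoly_deg_less_def)
  define P' where "P' = (\<lambda>x. \<Sum>i<n. real i *\<^sub>R x ^ (i - 1) *\<^sub>R A i)"
  have "(P has_vector_derivative P' x) (at x)" for x
  proof -
    have "((\<lambda>x. \<Sum>i<n. x ^ i *\<^sub>R A i) has_vector_derivative P' x) (at x)"
      unfolding P'_def by (intro has_vector_derivative_sum) (auto intro!: derivative_eq_intros)
    then show ?thesis by (simp flip: A)
  qed
  moreover have "mpoly_deg_less (n - 1) (\<lambda>x. real i *\<^sub>R x ^ (i - 1) *\<^sub>R A i)" if "i < n" for i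
  \<comment> \<open>At \<open>i = 0\<close> the truncated exponent is harmless because the factor
    \<open>real i\<close> is zero.\<close>
  proof (cases i)
    case (Suc j)
    then show ?thesis using that
      by (intro mpoly_deg_less_scaleR mpoly_deg_less_mono[OF mpoly_deg_less_monomial]) auto
  qed simp
  then have "mpoly_deg_less (n - 1) P'"
    unfolding P'_def by (intro mpoly_deg_less_sum) auto
  ultimately show ?thesis using that by blast
qed

lemma mpoly_deg_less_mderiv: "mpoly_deg_less n P \<Longrightarrow> mpoly_deg_less (n - k) (mderiv k P)"
proof (induction k)
  case (Suc k)
  then obtain P' where "mpoly_deg_less (n - k - 1) P'" "\<And>x. (mderiv k P has_vector_derivative P' x) (at x)"
    by (meson mpoly_has_vector_derivative)
  moreover from this(2) have "mderiv (Suc k) P = P'" by (simp add: vector_derivative_at fun_eq_iff)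
  ultimately show ?case by simp
qed simp

lemma is_mpoly_mderiv: "is_mpoly P \<Longrightarrow> is_mpoly (mderiv k P)"
  by (elim is_mpolyE) (rule is_mpolyI, rule mpoly_deg_less_mderiv)

lemma is_mpoly_smooth: "is_mpoly P \<Longrightarrow> smooth_fun P"
  by (rule smooth_funI) (meson is_mpolyE mpoly_has_vector_derivative is_mpoly_mderiv)

section \<open>Action of a differential operator on functions and matrix polynomials\<close>

lemma dop_apply_add:
  "smooth_fun P \<Longrightarrow> smooth_fun Q \<Longrightarrow>
    dop_apply D (\<lambda>x. P x + Q x) = (\<lambda>x. dop_apply D P x + dop_apply D Q x)"
  by (simp add: dop_apply_def mderiv_add mmul_add_left sum.distrib fun_eq_iff)

lemma dop_apply_mult:
  "smooth_fun P \<Longrightarrow> dop_apply D (\<lambda>x. A ** P x) = (\<lambda>x. A ** dop_apply D P x)"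
  by (simp add: dop_apply_def mderiv_linear[OF mmul_bounded_linear_right] mmul_sum_right matrix_mul_assoc fun_eq_iff)

lemma dop_apply_scaleR:
  "smooth_fun P \<Longrightarrow> dop_apply D (\<lambda>x. c *\<^sub>R P x) = (\<lambda>x. c *\<^sub>R dop_apply D P x)"
  by (simp add: dop_apply_def mderiv_linear[OF bounded_linear_scaleR_right] mmul_scaleR_left scaleR_sum_right fun_eq_iff)

lemma dop_apply_zero: "dop_apply D (\<lambda>x. 0) = (\<lambda>x. 0)"
  using dop_apply_scaleR[of "\<lambda>x. 0" D 0] is_mpoly_smooth[OF is_mpoly_zero] by simp

lemma dop_apply_cong_open:
  assumes "open S" "\<And>x. x \<in> S \<Longrightarrow> F x = G x" "x \<in> S"
  shows "dop_apply D F x = dop_apply D G x"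
  unfolding dop_apply_def using mderiv_cong_open[OF assms] by simp

lemma is_mpoly_dop_apply:
  assumes "poly_coeff_op D" "is_mpoly P"
  shows "is_mpoly (dop_apply D P)"
proof -
  have "is_mpoly (\<lambda>x. \<Sum>i<length D. mderiv i P x ** (D ! i) x)"
    using assms by (intro is_mpoly_sum is_mpoly_mult is_mpoly_mderiv) (auto simp: poly_coeff_op_def)
  then show ?thesis by (simp add: dop_apply_def[abs_def])
qed

text \<open>The \<open>i\<close>-th derivative lowers the degree by \<open>i\<close> and the
  coefficient raises it by at most \<open>i\<close>; once \<open>i\<close> reaches \<open>n\<close>
  the derivative is already zero.\<close>

lemma mpoly_deg_less_dop_apply:
  assumes "\<forall>i<length D. mpoly_deg_le i (D ! i)" "mpoly_deg_less n P"
  shows "mpoly_deg_less n (dop_apply D P)"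
proof -
  have "mpoly_deg_less n (\<lambda>x. mderiv i P x ** (D ! i) x)" if "i < length D" for i
  proof (cases "i < n")
    case True
    then have "mpoly_deg_less (Suc (n - i - 1)) (mderiv i P)"
      using mpoly_deg_less_mderiv[OF assms(2), of i] by (simp add: Suc_diff_Suc)
    moreover have "mpoly_deg_less (Suc i) (D ! i)"
      using assms(1) that by (simp add: mpoly_deg_le_iff)
    ultimately have "mpoly_deg_less (n - i - 1 + Suc i) (\<lambda>x. mderiv i P x ** (D ! i) x)"
      by (rule mpoly_deg_less_mult)
    then show ?thesis using True by simp
  next
    case False
    then have "mderiv i P = (\<lambda>x. 0)"
      using mpoly_deg_less_mderiv[OF assms(2), of i] by (simp add: mpoly_deg_less_0)
    then show ?thesis by (simp add: mmul_zero_left)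
  qed
  then have "mpoly_deg_less n (\<lambda>x. \<Sum>i<length D. mderiv i P x ** (D ! i) x)"
    by (intro mpoly_deg_less_sum) auto
  then show ?thesis by (simp add: dop_apply_def[abs_def])
qed

text \<open>At the root \<open>a\<close> only the \<open>k\<close>-th derivative of the power
  survives, so each coefficient can be recovered from the action on polynomials.\<close>

lemma dop_apply_power_at_root:
  assumes "k < length D"
  shows "dop_apply D (\<lambda>x. (x - a) ^ k *\<^sub>R A) a = fact k *\<^sub>R (A ** (D ! k) a)"
proof -
  have "dop_apply D (\<lambda>x. (x - a) ^ k *\<^sub>R A) a =
      (\<Sum>i<length D. if i = k then fact k *\<^sub>R (A ** (D ! k) a) else 0)"
    unfolding dop_apply_def mderiv_power_scaleR_at_root
    by (intro sum.cong) (auto simp: mmul_scaleR_left mmul_zero_left)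
  then show ?thesis using assms by simp
qed

section \<open>The substitution $y = x^2$\<close>

text \<open>A class containing the composite with \<open>sqrt\<close> and closed under
  differentiation on \<open>y > 0\<close>. Exact coefficients are not tracked: its purpose is to
  show that all derivatives exist.\<close>

inductive sqrt_combination :: "(real \<Rightarrow> complex^'n^'n) \<Rightarrow> (real \<Rightarrow> complex^'n^'n) \<Rightarrow> bool" for F where
  base: "sqrt_combination F (\<lambda>y. (c * y powr r) *\<^sub>R mderiv m F (sqrt y))"
| add: "sqrt_combination F g \<Longrightarrow> sqrt_combination F h \<Longrightarrow> sqrt_combination F (\<lambda>y. g y + h y)"

lemma sqrt_combination_deriv:
  assumes "smooth_fun F" "sqrt_combination F g"
  shows "\<exists>g'. sqrt_combination F g' \<and> (\<forall>y>0. (g has_vector_derivative g' y) (at y))"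
  using assms(2)
proof induction
  case (base c r m)
  let ?g' = "\<lambda>y. (c * r * y powr (r - 1)) *\<^sub>R mderiv m F (sqrt y) +
    (c / 2 * y powr (r - 1/2)) *\<^sub>R mderiv (Suc m) F (sqrt y)"
  have "((\<lambda>y. (c * y powr r) *\<^sub>R mderiv m F (sqrt y)) has_vector_derivative ?g' y) (at y)"
    if "y > 0" for y
  proof -
    have "(sqrt has_vector_derivative (1 / (2 * sqrt y))) (at y)"
      using that by (auto intro!: derivative_eq_intros simp: divide_simps simp flip: has_real_derivative_iff_has_vector_derivative)
    from vector_diff_chain_at[OF this smooth_fun_deriv[OF assms(1)]]
    have *: "((\<lambda>y. mderiv m F (sqrt y)) has_vector_derivative
        (1 / (2 * sqrt y)) *\<^sub>R mderiv (Suc m) F (sqrt y)) (at y)"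
      by (simp add: o_def)
    have **: "((\<lambda>y. c * y powr r) has_field_derivative c * r * y powr (r - 1)) (at y)"
      using that by (auto intro!: derivative_eq_intros)
    \<comment> \<open>The inner derivative \<open>1 / (2 * sqrt y)\<close> lowers the exponent by
      one half, which stays within the class.\<close>
    have "y powr (r - 1/2) = y powr r / sqrt y"
      using that by (simp add: powr_diff powr_half_sqrt)
    then show ?thesis
      using has_vector_derivative_scaleR[OF ** *] by (simp add: add.commute)
  qed
  moreover have "sqrt_combination F ?g'"
    by (intro sqrt_combination.intros)
  ultimately show ?case by blast
next
  case (add g h)
  then obtain g' h' where g': "sqrt_combination F g'" "\<forall>y>0. (g has_vector_derivative g' y) (at y)"
    and h': "sqrt_combination F h'" "\<forall>y>0. (h has_vector_derivative h' y) (at y)" by blast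
  show ?case
    using g' h' by (intro exI[of _ "\<lambda>y. g' y + h' y"] conjI allI impI sqrt_combination.add
      has_vector_derivative_add) auto
qed

text \<open>\<open>vector_derivative\<close> carries no information where no derivative exists, so
  the chain rule for iterated derivatives first requires genuine differentiability.\<close>

lemma sqrt_compose_deriv:
  fixes F :: "real \<Rightarrow> complex^'n^'n"
  assumes "smooth_fun F" "y > 0"
  shows "(mderiv k (\<lambda>y. F (sqrt y)) has_vector_derivative mderiv (Suc k) (\<lambda>y. F (sqrt y)) y) (at y)"
proof -
  let ?G = "\<lambda>y. F (sqrt y)"
  have deriv: "(mderiv k ?G has_vector_derivative d) (at z)"
    if "\<And>y. y > 0 \<Longrightarrow> mderiv k ?G y = g y" "(g has_vector_derivative d) (at z)" "z > 0" for k g d z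
    using that(2) by (rule has_vector_derivative_transform_within_open[of _ _ _ "{0<..}"]) (use that in auto)
  have "\<exists>g. sqrt_combination F g \<and> (\<forall>y>0. mderiv k ?G y = g y)" for k
  proof (induction k)
    case 0
    show ?case
      using sqrt_combination.base[of F 1 0 0] by (intro exI conjI) auto
  next
    case (Suc k)
    then obtain g where g: "sqrt_combination F g" "\<And>y. y > 0 \<Longrightarrow> mderiv k ?G y = g y" by blast
    obtain g' where g': "sqrt_combination F g'" "\<And>y. y > 0 \<Longrightarrow> (g has_vector_derivative g' y) (at y)"
      using sqrt_combination_deriv[OF assms(1) g(1)] by blast
    have "\<forall>y>0. mderiv (Suc k) ?G y = g' y"
      unfolding mderiv.simps by (intro allI impI vector_derivative_at deriv[OF g(2) g'(2)])
    then show ?case using g' by blast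
  qed
  then obtain g where g: "sqrt_combination F g" "\<And>y. y > 0 \<Longrightarrow> mderiv k ?G y = g y" by blast
  obtain g' where g': "\<And>y. y > 0 \<Longrightarrow> (g has_vector_derivative g' y) (at y)"
    using sqrt_combination_deriv[OF assms(1) g(1)] by blast
  have "(mderiv k ?G has_vector_derivative g' y) (at y)" using assms(2) by (intro deriv[OF g(2) g'])
  then show ?thesis by (simp add: vector_derivative_at)
qed

text \<open>The coefficients in the chain rule
  \<open>d\<^sup>iF/dx\<^sup>i (x) = (\<Sum>j\<le>i. chain_coeff i j x * d\<^sup>jG/dy\<^sup>j (x\<^sup>2))\<close> for \<open>F x = G (x\<^sup>2)\<close>.\<close>

primrec chain_coeff :: "nat \<Rightarrow> nat \<Rightarrow> real poly" where
  "chain_coeff 0 j = (if j = 0 then 1 else 0)"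
| "chain_coeff (Suc i) j =
    pderiv (chain_coeff i j) + (case j of 0 \<Rightarrow> 0 | Suc k \<Rightarrow> [:0, 2:] * chain_coeff i k)"

lemma chain_coeff_eq_0: "i < j \<Longrightarrow> chain_coeff i j = 0"
  by (induction i arbitrary: j) (auto split: nat.splits)

text \<open>Both sides of the functional equation are differentiated and compared by uniqueness of
  derivatives; \<open>c\<close> is later a sign.\<close>

lemma poly_pderiv_parity:
  fixes p :: "real poly"
  assumes "\<And>x. poly p (- x) = c * poly p x"
  shows "poly (pderiv p) (- x) = - c * poly (pderiv p) x"
proof -
  have "((\<lambda>x. poly p (- x)) has_field_derivative - poly (pderiv p) (- x)) (at x)"
    by (auto intro!: derivative_eq_intros)
  moreover have "((\<lambda>x. poly p (- x)) has_field_derivative c * poly (pderiv p) x) (at x)"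
    unfolding assms by (auto intro!: derivative_eq_intros)
  ultimately have "- poly (pderiv p) (- x) = c * poly (pderiv p) x" by (rule DERIV_unique)
  then show ?thesis by simp
qed

text \<open>Each term of the recursion either differentiates or multiplies by \<open>2 * x\<close>,
  and both reverse parity; hence the sign depends only on \<open>i\<close>.\<close>

lemma chain_coeff_parity: "poly (chain_coeff i j) (- x) = (-1) ^ i * poly (chain_coeff i j) x"
proof (induction i arbitrary: j x)
  case (Suc i)
  then show ?case
    by (simp add: poly_pderiv_parity[OF Suc.IH] algebra_simps split: nat.splits)
qed simp

lemma mderiv_sqrt_compose:
  fixes F :: "real \<Rightarrow> complex^'n^'n"
  assumes "smooth_fun F" "x > 0"
  shows "mderiv i F x = (\<Sum>j\<le>i. poly (chain_coeff i j) x *\<^sub>R mderiv j (\<lambda>y. F (sqrt y)) (x\<^sup>2))"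
  using assms(2)
proof (induction i arbitrary: x)
  case (Suc i)
  let ?G = "\<lambda>y. F (sqrt y)"
  let ?g' = "\<Sum>j\<le>i. poly (chain_coeff i j) x *\<^sub>R (2 * x) *\<^sub>R mderiv (Suc j) ?G (x\<^sup>2) +
       poly (pderiv (chain_coeff i j)) x *\<^sub>R mderiv j ?G (x\<^sup>2)"
  have "((\<lambda>x. \<Sum>j\<le>i. poly (chain_coeff i j) x *\<^sub>R mderiv j ?G (x\<^sup>2)) has_vector_derivative ?g') (at x)"
  proof (intro has_vector_derivative_sum has_vector_derivative_scaleR)
    fix j
    have "((\<lambda>x. x\<^sup>2) has_vector_derivative 2 * x) (at x)"
      by (auto intro!: derivative_eq_intros simp flip: has_real_derivative_iff_has_vector_derivative)
    from vector_diff_chain_at[OF this sqrt_compose_deriv[OF assms(1)]] Suc.prems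
    show "((\<lambda>x. mderiv j ?G (x\<^sup>2)) has_vector_derivative (2 * x) *\<^sub>R mderiv (Suc j) ?G (x\<^sup>2)) (at x)"
      by (simp add: o_def)
  qed (rule poly_DERIV)
  then have "(mderiv i F has_vector_derivative ?g') (at x)"
    by (rule has_vector_derivative_transform_within_open[of _ _ _ "{0<..}"]) (use Suc in auto)
  then have "mderiv (Suc i) F x = ?g'" by (simp add: vector_derivative_at)
  also have "\<dots> = (\<Sum>j\<le>i. poly ([:0, 2:] * chain_coeff i j) x *\<^sub>R mderiv (Suc j) ?G (x\<^sup>2)) +
      (\<Sum>j\<le>Suc i. poly (pderiv (chain_coeff i j)) x *\<^sub>R mderiv j ?G (x\<^sup>2))"
    by (simp add: sum.distrib chain_coeff_eq_0 mult_ac del: mderiv.simps)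
  \<comment> \<open>The factor \<open>2 * x\<close> from the inner square comes with the next
    derivative, so the sum is reindexed with a zero in position 0.\<close>
  also have "(\<Sum>j\<le>i. poly ([:0, 2:] * chain_coeff i j) x *\<^sub>R mderiv (Suc j) ?G (x\<^sup>2)) =
     (\<Sum>j\<le>Suc i. poly (case j of 0 \<Rightarrow> 0 | Suc k \<Rightarrow> [:0, 2:] * chain_coeff i k) x *\<^sub>R mderiv j ?G (x\<^sup>2))"
    by (subst sum.atMost_Suc_shift) (simp del: mderiv.simps)
  also have "\<dots> + (\<Sum>j\<le>Suc i. poly (pderiv (chain_coeff i j)) x *\<^sub>R mderiv j ?G (x\<^sup>2)) =
    (\<Sum>j\<le>Suc i. poly (chain_coeff (Suc i) j) x *\<^sub>R mderiv j ?G (x\<^sup>2))"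
    unfolding sum.distrib[symmetric] chain_coeff.simps poly_add scaleR_left_distrib
    by (simp only: add.commute)
  finally show ?case .
qed simp

lemma tilde_op_exists:
  fixes D :: "(real \<Rightarrow> complex^'n^'n) list"
  assumes "poly_coeff_op D"
    and parity: "\<And>i x. i < length D \<Longrightarrow> (D ! i) (- x) = (-1) ^ i *\<^sub>R (D ! i) x"
  shows "\<exists>Dt. poly_coeff_op Dt \<and> tilde_op D Dt"
proof -
  let ?s = "length D"
  \<comment> \<open>\<open>H j\<close> is the total factor of the \<open>j\<close>-th derivative in
    \<open>y\<close>, still as a function of \<open>x\<close>. It is even because both factors of
    its \<open>i\<close>-th summand have the parity of \<open>i\<close>.\<close>
  define H where "H = (\<lambda>j x. \<Sum>i<?s. poly (chain_coeff i j) x *\<^sub>R (D ! i) x)"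
  have "is_mpoly (\<lambda>x. poly p x *\<^sub>R A x)" if "is_mpoly A" for p and A :: "real \<Rightarrow> complex^'n^'n"
  proof -
    have "is_mpoly (\<lambda>x. \<Sum>i\<le>degree p. coeff p i *\<^sub>R x ^ i *\<^sub>R A x)"
      by (intro is_mpoly_sum is_mpoly_scaleR is_mpoly_power_scaleR that)
    then show ?thesis by (simp add: poly_altdef scaleR_sum_left)
  qed
  then have "is_mpoly (H j)" for j
    unfolding H_def using assms(1) by (intro is_mpoly_sum) (auto simp: poly_coeff_op_def)
  moreover have "H j (- x) = H j x" for j x
    unfolding H_def by (intro sum.cong) (auto simp: parity chain_coeff_parity simp flip: power_mult_distrib)
  ultimately have "\<forall>j. \<exists>Q. is_mpoly Q \<and> (\<forall>x. H j x = Q (x\<^sup>2))"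
    by (intro allI, rule even_mpoly_obtain) auto
  then obtain Q where "\<forall>j. is_mpoly (Q j) \<and> (\<forall>x. H j x = Q j (x\<^sup>2))"
    by (rule choice[elim_format]) blast
  then have Q: "\<And>j. is_mpoly (Q j)" "\<And>j x. H j x = Q j (x\<^sup>2)" by auto
  define Dt where "Dt = map Q [0..<?s]"
  have "poly_coeff_op Dt" by (simp add: poly_coeff_op_def Dt_def Q)
  moreover have "tilde_op D Dt"
    unfolding tilde_op_def
  proof (intro allI impI)
    fix F :: "real \<Rightarrow> complex^'n^'n" and y :: real
    assume F: "smooth_fun F" and y: "y > 0"
    let ?G = "\<lambda>y. F (sqrt y)"
    have "dop_apply D F (sqrt y) =
        (\<Sum>i<?s. (\<Sum>j\<le>i. poly (chain_coeff i j) (sqrt y) *\<^sub>R mderiv j ?G y) ** (D ! i) (sqrt y))"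
      using y mderiv_sqrt_compose[OF F, of "sqrt y"] by (simp add: dop_apply_def)
    \<comment> \<open>Padding the inner sum with zero terms removes its dependence on
      \<open>i\<close>, so that the two sums can be interchanged.\<close>
    also have "\<dots> = (\<Sum>i<?s. (\<Sum>j<?s. poly (chain_coeff i j) (sqrt y) *\<^sub>R mderiv j ?G y) ** (D ! i) (sqrt y))"
      by (intro sum.cong arg_cong2[where f = "(**)"] refl sum.mono_neutral_left)
        (auto simp: chain_coeff_eq_0)
    also have "\<dots> = (\<Sum>j<?s. mderiv j ?G y ** H j (sqrt y))"
      unfolding H_def mmul_sum_left mmul_sum_right mmul_scaleR_left mmul_scaleR_right
      by (rule sum.swap)
    also have "\<dots> = dop_apply Dt ?G y"
      using y by (simp add: dop_apply_def Dt_def Q)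
    finally show "dop_apply D F (sqrt y) = dop_apply Dt ?G y" .
  qed
  ultimately show ?thesis by blast
qed

lemma tilde_op_apply:
  assumes "tilde_op D Dt" "is_mpoly P" "y > 0"
  shows "dop_apply Dt P y = dop_apply D (\<lambda>x. P (x\<^sup>2)) (sqrt y)"
proof -
  \<comment> \<open>The square of \<open>sqrt y\<close> agrees with \<open>y\<close> only for
    nonnegative \<open>y\<close>, so \<open>P\<close> is replaced locally on the open half
    line.\<close>
  have "dop_apply Dt P y = dop_apply Dt (\<lambda>y. P ((sqrt y)\<^sup>2)) y"
    by (rule dop_apply_cong_open[of "{0<..}"]) (use assms(3) in auto)
  also have "\<dots> = dop_apply D (\<lambda>x. P (x\<^sup>2)) (sqrt y)"
    using assms is_mpoly_smooth[OF is_mpoly_compose_square[OF assms(2)]]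
    by (simp add: tilde_op_def)
  finally show ?thesis .
qed

lemma tilde_op_apply_square:
  assumes "tilde_op D Dt" "poly_coeff_op D" "poly_coeff_op Dt" "is_mpoly P"
  shows "dop_apply Dt P (x\<^sup>2) = dop_apply D (\<lambda>x. P (x\<^sup>2)) x"
proof (rule mpoly_eqI)
  show "is_mpoly (\<lambda>x. dop_apply Dt P (x\<^sup>2))" "is_mpoly (dop_apply D (\<lambda>x. P (x\<^sup>2)))"
    using assms by (intro is_mpoly_compose_square is_mpoly_dop_apply; simp)+
  show "dop_apply Dt P (x\<^sup>2) = dop_apply D (\<lambda>x. P (x\<^sup>2)) x" if "x > 0" for x
    using tilde_op_apply[OF assms(1,4), of "x\<^sup>2"] that by simp
qed

text \<open>The action on \<open>y ^ k\<close> times the identity is triangular: it is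
  \<open>fact k\<close> times the \<open>k\<close>-th coefficient plus terms with earlier
  coefficients, which strong induction already controls.\<close>

lemma coeff_degree_of_degree_preserving:
  fixes D :: "(real \<Rightarrow> complex^'n^'n) list"
  assumes "\<And>k. mpoly_deg_less (Suc k) (dop_apply D (\<lambda>y. y ^ k *\<^sub>R mat 1))" "k < length D"
  shows "mpoly_deg_less (Suc k) (D ! k)"
  using assms(2)
proof (induction k rule: less_induct)
  case (less k)
  let ?c = "\<lambda>j y. (\<Prod>l<j. real (k - l)) * y ^ (k - j)"
  have fact: "(\<Prod>l<k. real (k - l)) = fact k"
    unfolding fact_prod_rev by (simp add: atLeast0LessThan)
  have "dop_apply D (\<lambda>y. y ^ k *\<^sub>R mat 1) y = (\<Sum>j<k. ?c j y *\<^sub>R (D ! j) y) + fact k *\<^sub>R (D ! k) y" for y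
  proof -
    have "dop_apply D (\<lambda>y. y ^ k *\<^sub>R mat 1) y = (\<Sum>j<length D. ?c j y *\<^sub>R (D ! j) y)"
      using mderiv_power_scaleR[of _ 0 k "mat 1 :: complex^'n^'n"] by (simp add: dop_apply_def mmul_scaleR_left)
    \<comment> \<open>For \<open>j > k\<close> the falling product contains the factor
      \<open>k - k\<close>, so the later coefficients drop out.\<close>
    also have "\<dots> = (\<Sum>j<Suc k. ?c j y *\<^sub>R (D ! j) y)"
      using less.prems by (intro sum.mono_neutral_right) auto
    finally show ?thesis unfolding sum.lessThan_Suc fact by simp
  qed
  then have eq: "(1 / fact k) *\<^sub>R (dop_apply D (\<lambda>y. y ^ k *\<^sub>R mat 1) y - (\<Sum>j<k. ?c j y *\<^sub>R (D ! j) y)) = (D ! k) y" for y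
    by simp
  have "mpoly_deg_less (Suc k) (\<lambda>y. ?c j y *\<^sub>R (D ! j) y)" if "j < k" for j
  proof -
    have "mpoly_deg_less (Suc j) (D ! j)" using less that by auto
    then have "mpoly_deg_less (k - j + Suc j) (\<lambda>y. (\<Prod>l<j. real (k - l)) *\<^sub>R y ^ (k - j) *\<^sub>R (D ! j) y)"
      by (intro mpoly_deg_less_scaleR mpoly_deg_less_power_scaleR)
    then show ?thesis using that by simp
  qed
  then have "mpoly_deg_less (Suc k) (\<lambda>y. (1 / fact k) *\<^sub>R
      (dop_apply D (\<lambda>y. y ^ k *\<^sub>R mat 1) y - (\<Sum>j<k. ?c j y *\<^sub>R (D ! j) y)))"
    by (intro mpoly_deg_less_scaleR mpoly_deg_less_diff mpoly_deg_less_sum assms) auto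
  then show ?case by (simp only: eq)
qed

section \<open>The matrix inner product\<close>

lemma set_integrable_sum:
  fixes f :: "'i \<Rightarrow> 'a \<Rightarrow> 'b::{banach, second_countable_topology}"
  assumes "\<And>i. i \<in> I \<Longrightarrow> set_integrable M A (f i)"
  shows "set_integrable M A (\<lambda>x. \<Sum>i\<in>I. f i x)"
  using assms unfolding set_integrable_def scaleR_sum_right by (intro Bochner_Integration.integrable_sum)

lemma set_integral_sum:
  fixes f :: "'i \<Rightarrow> 'a \<Rightarrow> 'b::{banach, second_countable_topology}"
  assumes "\<And>i. i \<in> I \<Longrightarrow> set_integrable M A (f i)"
  shows "(LINT x:A|M. \<Sum>i\<in>I. f i x) = (\<Sum>i\<in>I. LINT x:A|M. f i x)"
  using assms unfolding set_integrable_def set_lebesgue_integral_def scaleR_sum_right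
  by (intro Bochner_Integration.integral_sum)

text \<open>\<open>I_nonnull\<close> ensures that a property holding almost everywhere on
  \<open>I\<close> holds at infinitely many points, so that \<open>mip\<close> can separate
  polynomials.\<close>

locale matrix_weight =
  fixes I :: "real set" and W :: "real \<Rightarrow> complex^'n^'n"
  assumes moments: "set_integrable lborel I (\<lambda>x. complex_of_real (x ^ n) * W x $ i $ j)"
    and pos_def: "AE x in lborel. x \<in> I \<longrightarrow> pos_def_mat (W x)"
    and I_sets: "I \<in> sets lborel"
    and I_nonnull: "I \<notin> null_sets lborel"
begin

lemma integrable_mip:
  assumes "is_mpoly P" "is_mpoly Q"
  shows "set_integrable lborel I (\<lambda>x. (P x ** W x ** madj (Q x)) $ i $ j)"
proof -
  obtain n m where "mpoly_deg_less n P" "mpoly_deg_less m Q" using assms by (auto elim!: is_mpolyE)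
  then obtain A B where A: "\<And>x. P x = (\<Sum>a<n. x ^ a *\<^sub>R A a)" and B: "\<And>x. Q x = (\<Sum>b<m. x ^ b *\<^sub>R B b)"
    by (auto simp: mpoly_deg_less_def)
  have "(P x ** W x ** madj (Q x)) $ i $ j = 
    (\<Sum>l\<in>UNIV. \<Sum>b<m. \<Sum>k\<in>UNIV. \<Sum>a<n. (A a $ i $ k * cnj (B b $ j $ l)) * (complex_of_real (x ^ (a + b)) * W x $ k $ l))" for x
    unfolding A B matrix_mult_component madj_component sum_component vector_scaleR_component
      cnj_sum sum_distrib_left sum_distrib_right
    by (intro sum.cong refl) (simp add: scaleR_conv_of_real power_add mult_ac)
  then show ?thesis
    by (simp only:) (intro set_integrable_sum set_integrable_mult_right moments)
qed

lemma mip_add_left: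
  assumes "is_mpoly P" "is_mpoly Q" "is_mpoly R"
  shows "mip I W (\<lambda>x. P x + Q x) R = mip I W P R + mip I W Q R"
  using integrable_mip[OF assms(1,3)] integrable_mip[OF assms(2,3)]
  by (simp add: mip_def vec_eq_iff mmul_add_left)

lemma mip_mult_left:
  assumes "is_mpoly P" "is_mpoly Q"
  shows "mip I W (\<lambda>x. A ** P x) Q = A ** mip I W P Q"
proof -
  have "(A ** P x ** W x ** madj (Q x)) $ i $ j = (\<Sum>k\<in>UNIV. A $ i $ k * (P x ** W x ** madj (Q x)) $ k $ j)" for x i j
    by (simp add: matrix_mult_component flip: matrix_mul_assoc)
  then show ?thesis
    using integrable_mip[OF assms] by (simp add: mip_def vec_eq_iff matrix_mult_component set_integral_sum)
qed

text \<open>\<open>W x\<close> is self-adjoint only almost everywhere, so the two integrals are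
  compared through an almost-everywhere identity. The sum and product rules for the right argument
  then come from those for the left one.\<close>

lemma mip_adjoint:
  assumes "is_mpoly P" "is_mpoly Q"
  shows "mip I W Q P = madj (mip I W P Q)"
proof -
  have "(LBINT x:I. (Q x ** W x ** madj (P x)) $ i $ j) = cnj (LBINT x:I. (P x ** W x ** madj (Q x)) $ j $ i)" for i j
  proof -
    have "AE x in lborel. indicator I x *\<^sub>R (Q x ** W x ** madj (P x)) $ i $ j = 
        cnj (indicator I x *\<^sub>R (P x ** W x ** madj (Q x)) $ j $ i)"
      using pos_def
    proof eventually_elim
      case (elim x)
      have "Q x ** W x ** madj (P x) = madj (P x ** W x ** madj (Q x))" if "x \<in> I"
        using elim that by (simp add: madj_mult madj_madj matrix_mul_assoc pos_def_mat_def)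
      then show ?case by (auto simp: madj_component split: split_indicator)
    qed
    moreover have "(\<lambda>x. indicator I x *\<^sub>R (Q x ** W x ** madj (P x)) $ i $ j) \<in> borel_measurable lborel"
      using integrable_mip[OF assms(2,1), of i j] unfolding set_integrable_def by (rule borel_measurable_integrable)
    moreover have "(\<lambda>x. cnj (indicator I x *\<^sub>R (P x ** W x ** madj (Q x)) $ j $ i)) \<in> borel_measurable lborel"
      using integrable_mip[OF assms, of j i] unfolding set_integrable_def by (intro borel_measurable_integrable integrable_cnj)
    ultimately have "(\<integral>x. indicator I x *\<^sub>R (Q x ** W x ** madj (P x)) $ i $ j \<partial>lborel) =
        (\<integral>x. cnj (indicator I x *\<^sub>R (P x ** W x ** madj (Q x)) $ j $ i) \<partial>lborel)"
      by (intro integral_cong_AE)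
    then show ?thesis
      unfolding set_lebesgue_integral_def Bochner_Integration.integral_cnj .
  qed
  then show ?thesis by (simp add: mip_def vec_eq_iff madj_component)
qed

lemma mip_add_right:
  assumes "is_mpoly P" "is_mpoly Q" "is_mpoly R"
  shows "mip I W R (\<lambda>x. P x + Q x) = mip I W R P + mip I W R Q"
  using assms by (simp add: mip_adjoint[of _ R] mip_add_left is_mpoly_add linear_add[OF linear_madj])

lemma mip_mult_right:
  assumes "is_mpoly P" "is_mpoly Q"
  shows "mip I W P (\<lambda>x. A ** Q x) = mip I W P Q ** madj A"
  using assms by (simp add: mip_adjoint[of _ P] mip_mult_left is_mpoly_const_mult madj_mult)

lemma mip_zero_right: "mip I W P (\<lambda>x. 0) = 0"
  by (simp add: mip_def vec_eq_iff linear_0[OF linear_madj] mmul_zero_right)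

text \<open>The quadratic form of \<open>mip I W P P\<close> at \<open>v\<close> is the integral of
  the nonnegative form of \<open>W x\<close> at \<open>u x = madj (P x) *v v\<close>. If it is zero,
  \<open>u\<close> vanishes almost everywhere on \<open>I\<close>, hence at infinitely many points,
  and the entries of \<open>u\<close> are polynomials.\<close>

lemma mip_self_kernel:
  assumes "is_mpoly P" "mip I W P P *v v = 0"
  shows "madj (P x) *v v = 0"
proof -
  define u where "u x = madj (P x) *v v" for x
  define q where "q x = (\<Sum>i\<in>UNIV. cnj (u x $ i) * (W x *v u x) $ i)" for x
  have q: "q x = (\<Sum>i\<in>UNIV. \<Sum>j\<in>UNIV. (cnj (v $ i) * v $ j) * (P x ** W x ** madj (P x)) $ i $ j)" for x
  proof -
    have u: "u x $ k = (\<Sum>i\<in>UNIV. cnj (P x $ i $ k) * v $ i)" for k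
      by (simp add: u_def matrix_vector_mult_def madj_component)
    have "q x = (\<Sum>k\<in>UNIV. \<Sum>i\<in>UNIV. cnj (v $ i) * (P x $ i $ k * (W x *v u x) $ k))"
      unfolding q_def u complex_cnj_mult cnj_sum sum_distrib_right by (simp add: mult_ac)
    also have "\<dots> = (\<Sum>i\<in>UNIV. cnj (v $ i) * (P x *v (W x *v u x)) $ i)"
      by (subst sum.swap) (simp add: matrix_vector_mult_def[of "P x"] sum_distrib_left)
    also have "P x *v (W x *v u x) = (P x ** W x ** madj (P x)) *v v"
      by (simp add: u_def matrix_vector_mul_assoc matrix_mul_assoc)
    finally show ?thesis
      by (simp add: matrix_vector_mult_def sum_distrib_left mult_ac)
  qed
  have q_int: "set_integrable lborel I q"
    unfolding q by (intro set_integrable_sum set_integrable_mult_right integrable_mip assms)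
  have "(LBINT x:I. q x) = (\<Sum>i\<in>UNIV. cnj (v $ i) * (mip I W P P *v v) $ i)"
    using integrable_mip[OF assms(1,1)] unfolding q
    by (simp add: set_integral_sum set_integrable_sum mip_def matrix_vector_mult_def sum_distrib_left mult_ac)
  then have "integral\<^sup>L lborel (\<lambda>x. Re (indicator I x *\<^sub>R q x)) = 0"
    unfolding Bochner_Integration.integral_Re[OF q_int[unfolded set_integrable_def]]
    by (simp add: assms set_lebesgue_integral_def)
  moreover have "AE x in lborel. 0 \<le> Re (indicator I x *\<^sub>R q x)"
    using pos_def
  proof eventually_elim
    case (elim x)
    show ?case
    proof (cases "x \<in> I \<and> u x \<noteq> 0")
      case True
      then show ?thesis using elim by (auto simp: pos_def_mat_def q_def intro!: less_imp_le)
    qed (auto simp: q_def)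
  qed
  moreover have "integrable lborel (\<lambda>x. Re (indicator I x *\<^sub>R q x))"
    using q_int unfolding set_integrable_def by (rule integrable_Re)
  ultimately have "AE x in lborel. Re (indicator I x *\<^sub>R q x) = 0"
    by (subst integral_nonneg_eq_0_iff_AE[symmetric])
  with pos_def have "AE x in lborel. x \<in> I \<longrightarrow> u x = 0"
  proof eventually_elim
    case (elim x)
    then show ?case by (auto simp: pos_def_mat_def q_def)
  qed
  then have ae: "AE x in lborel. x \<notin> I - {x. u x = 0}" by eventually_elim auto
  \<comment> \<open>With only finitely many zeros of \<open>u\<close>, the interval would be covered
    by two null sets.\<close>
  have inf: "infinite {x. u x = 0}"
  proof
    assume fin: "finite {x. u x = 0}"
    have "I - {x. u x = 0} \<in> sets lborel"
      using I_sets null_setsD2[OF finite_imp_null_set_lborel[OF fin]] by (rule sets.Diff)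
    with ae have "I - {x. u x = 0} \<in> null_sets lborel"
      by (subst AE_iff_null_sets)
    moreover have "{x. u x = 0} \<in> null_sets lborel" using fin by (rule finite_imp_null_set_lborel)
    ultimately have "(I - {x. u x = 0}) \<union> {x. u x = 0} \<in> null_sets lborel" by (rule null_sets.Un)
    then have "I \<in> null_sets lborel" by (rule null_sets_subset) (use I_sets in auto)
    then show False using I_nonnull by simp
  qed
  obtain n A where A: "\<And>x. P x = (\<Sum>a<n. x ^ a *\<^sub>R A a)"
    using assms(1) by (auto elim!: is_mpolyE simp: mpoly_deg_less_def)
  have u: "u x = (\<Sum>a<n. x ^ a *\<^sub>R (madj (A a) *v v))" for x
  proof -
    have "u x $ i = (\<Sum>a<n. x ^ a *\<^sub>R (madj (A a) *v v)) $ i" for i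
      unfolding u_def A matrix_vector_mult_def
      by (simp add: madj_component scaleR_sum_right sum_distrib_right) (rule sum.swap)
    then show ?thesis by (simp add: vec_eq_iff)
  qed
  have "madj (A a) *v v = 0" if "a < n" for a
  proof -
    have "(madj (A a) *v v) $ i = 0" for i
    proof (rule real_poly_coeffs_eq_zero[OF _ that])
      have "{x. u x = 0} \<subseteq> {x. (\<Sum>a<n. x ^ a *\<^sub>R (madj (A a) *v v) $ i) = 0}"
      proof safe
        fix x assume "u x = 0"
        then have "u x $ i = 0" by simp
        then show "(\<Sum>a<n. x ^ a *\<^sub>R (madj (A a) *v v) $ i) = 0" by (simp add: u)
      qed
      then show "infinite {x. (\<Sum>a<n. x ^ a *\<^sub>R (madj (A a) *v v) $ i) = 0}"
        using inf by (rule infinite_super)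
    qed
    then show ?thesis by (simp add: vec_eq_iff)
  qed
  then have "u x = 0" by (simp add: u)
  then show ?thesis by (simp add: u_def)
qed

lemma mip_self_eq_0:
  assumes "is_mpoly P" "mip I W P P = 0"
  shows "P x = 0"
proof -
  have "madj (P x) *v v = 0" for v
    using mip_self_kernel[OF assms(1)] by (simp add: assms(2))
  then have "madj (P x) = 0" by (simp add: matrix_eq)
  then have "madj (madj (P x)) = 0" by (simp add: linear_0[OF linear_madj])
  then show ?thesis by (simp add: madj_madj)
qed

section \<open>Monic orthogonal sequences and symmetric operators\<close>

lemma mip_monic_left_invertible:
  assumes "monic_mpoly n P"
  shows "\<exists>B. B ** mip I W P P = mat 1"
  unfolding matrix_left_invertible_ker
proof (intro allI impI)
  fix v :: "complex^'n"
  assume v: "mip I W P P *v v = 0"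
  obtain A where A: "A n = mat 1" "\<And>x. P x = (\<Sum>i<Suc n. x ^ i *\<^sub>R A i)"
    using assms by (auto simp: monic_mpoly_iff)
  have "is_mpoly P" using assms by (rule monic_mpoly_deg_less[THEN is_mpolyI])
  then have z: "madj (P x) *v v = 0" for x using v by (rule mip_self_kernel)
  \<comment> \<open>The top coefficient of \<open>P\<close> is the identity, so the top coefficient
    of the vanishing polynomial \<open>madj (P x) *v v\<close> is \<open>v\<close> itself.\<close>
  have "v $ i = 0" for i
  proof -
    have "(\<Sum>a<Suc n. x ^ a *\<^sub>R (madj (A a) *v v) $ i) = (madj (P x) *v v) $ i" for x
      unfolding A matrix_vector_mult_def
      by (simp add: madj_component scaleR_sum_right sum_distrib_right del: sum.lessThan_Suc) (rule sum.swap)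
    then have "{x::real. (\<Sum>a<Suc n. x ^ a *\<^sub>R (madj (A a) *v v) $ i) = 0} = UNIV" using z by simp
    then have "(madj (A n) *v v) $ i = 0"
      by (intro real_poly_coeffs_eq_zero[of "\<lambda>a. (madj (A a) *v v) $ i" "Suc n"]) (auto simp: infinite_UNIV_char_0)
    then show ?thesis by (simp add: A madj_mat_1)
  qed
  then show "v = 0" by (simp add: vec_eq_iff)
qed

text \<open>Gram-Schmidt by double induction: with the degree \<open>n\<close> fixed, orthogonality
  is extended one degree \<open>k\<close> at a time, the correction being a left multiple of the
  polynomial \<open>p\<close> of degree \<open>k\<close> supplied by the outer induction.\<close>

lemma monic_OPS_exists:
  obtains P where "monic_OPS I W P"
proof -
  have "\<exists>P. monic_mpoly n P \<and> (\<forall>Q. mpoly_deg_less k Q \<longrightarrow> mip I W P Q = 0)" if "k \<le> n" for k n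
    using that
  proof (induction n arbitrary: k rule: less_induct)
    case (less n)
    note outer = less.IH
    show ?case using less.prems
    proof (induction k)
      case 0
      have "monic_mpoly n (\<lambda>x. x ^ n *\<^sub>R mat 1)"
        unfolding monic_mpoly_iff by (intro exI[of _ "\<lambda>i. if i = n then mat 1 else 0"]) (auto simp: if_distrib)
      then show ?case by (auto simp: mpoly_deg_less_0 mip_zero_right)
    next
      case (Suc k)
      then obtain P where P: "monic_mpoly n P" "\<And>Q. mpoly_deg_less k Q \<Longrightarrow> mip I W P Q = 0" by auto
      obtain p where p: "monic_mpoly k p" "\<And>Q. mpoly_deg_less k Q \<Longrightarrow> mip I W p Q = 0"
        using outer[of k k] Suc.prems by auto
      obtain B where B: "B ** mip I W p p = mat 1" using mip_monic_left_invertible[OF p(1)] by blast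
      \<comment> \<open>\<open>C\<close> is the solution of
        \<open>mip I W P p + C ** mip I W p p = 0\<close>, obtained from the left inverse
        \<open>B\<close> of the Gram matrix.\<close>
      define C where "C = - (mip I W P p ** B)"
      define P' where "P' x = P x + C ** p x" for x
      have mp: "is_mpoly P" "is_mpoly p" using P(1) p(1) by (auto intro: is_mpolyI monic_mpoly_deg_less)
      have mip_P': "mip I W P' Q = mip I W P Q + C ** mip I W p Q" if "is_mpoly Q" for Q
        unfolding P'_def using mp that by (simp add: mip_add_left mip_mult_left is_mpoly_const_mult)
      have P'_p: "mip I W P' p = 0"
      proof -
        have "C ** mip I W p p = - (mip I W P p ** (B ** mip I W p p))"
          unfolding C_def using mmul_diff_left[of 0] by (simp add: matrix_mul_assoc)
        then show ?thesis using mip_P'[OF mp(2)] B by simp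
      qed
      have "mip I W P' Q = 0" if Q: "mpoly_deg_less (Suc k) Q" for Q
      proof -
        obtain A where A: "mpoly_deg_less k (\<lambda>x. Q x - A ** p x)"
          using monic_mpoly_division[OF p(1) Q] .
        have mA: "is_mpoly (\<lambda>x. Q x - A ** p x)" using A by (rule is_mpolyI)
        have mP': "is_mpoly P'" unfolding P'_def[abs_def] by (intro is_mpoly_add is_mpoly_const_mult mp)
        have "mip I W P' (\<lambda>x. (Q x - A ** p x) + A ** p x) = 0"
          using mip_add_right[OF mA is_mpoly_const_mult[OF mp(2)] mP', of A]
          by (simp add: mip_mult_right[OF mP' mp(2)] P'_p mip_P'[OF mA] P(2)[OF A] p(2)[OF A] mmul_zero_left mmul_zero_right)
        then show ?thesis by simp
      qed
      moreover have "monic_mpoly n P'"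
      proof -
        obtain A where A: "A n = mat 1" "\<And>x. P x = (\<Sum>i<Suc n. x ^ i *\<^sub>R A i)"
          using P(1) by (auto simp: monic_mpoly_iff)
        have "mpoly_deg_less n (\<lambda>x. C ** p x)"
          using Suc.prems by (intro mpoly_deg_less_mult_left mpoly_deg_less_mono[OF monic_mpoly_deg_less[OF p(1)]])
        then obtain E where E: "\<And>x. C ** p x = (\<Sum>i<n. x ^ i *\<^sub>R E i)" by (auto simp: mpoly_deg_less_def)
        show ?thesis unfolding monic_mpoly_iff
          by (rule exI[of _ "\<lambda>i. A i + (if i < n then E i else 0)"])
            (simp add: A E P'_def scaleR_add_right sum.distrib)
      qed
      ultimately show ?case by blast
    qed
  qed
  then have "\<forall>n. \<exists>P. monic_mpoly n P \<and> (\<forall>Q. mpoly_deg_less n Q \<longrightarrow> mip I W P Q = 0)" by blast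
  then obtain P where "\<forall>n. monic_mpoly n (P n) \<and> (\<forall>Q. mpoly_deg_less n Q \<longrightarrow> mip I W (P n) Q = 0)"
    by (rule choice[elim_format]) blast
  then have P: "\<And>n. monic_mpoly n (P n)" "\<And>n Q. mpoly_deg_less n Q \<Longrightarrow> mip I W (P n) Q = 0" by auto
  have lt: "mip I W (P n) (P m) = 0" if "m < n" for m n
    using that by (intro P(2) mpoly_deg_less_mono[OF monic_mpoly_deg_less[OF P(1)]]) simp
  \<comment> \<open>Orthogonality is known only against lower degrees; the reverse order follows by
    taking adjoints.\<close>
  have "mip I W (P m) (P n) = 0" if "m \<noteq> n" for m n
  proof (cases "m < n")
    case True
    have "mip I W (P m) (P n) = madj (mip I W (P n) (P m))"
      by (intro mip_adjoint P(1)[THEN monic_mpoly_deg_less, THEN is_mpolyI])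
    then show ?thesis using lt[OF True] by (simp add: linear_0[OF linear_madj])
  qed (use that lt in auto)
  then show ?thesis using P(1) by (intro that) (auto simp: monic_OPS_def)
qed

lemma monic_OPS_orthogonal:
  assumes "monic_OPS I W P" "mpoly_deg_less n Q"
  shows "mip I W (P n) Q = 0"
proof -
  have P: "monic_mpoly k (P k)" "k \<noteq> l \<Longrightarrow> mip I W (P k) (P l) = 0" for k l
    using assms(1) by (auto simp: monic_OPS_def)
  have mP: "is_mpoly (P k)" for k using P(1) by (rule monic_mpoly_deg_less[THEN is_mpolyI])
  show ?thesis
    using P(1) assms(2)
  proof (induction rule: mpoly_induct_monic)
    case zero
    then show ?case by (rule mip_zero_right)
  next
    case (basis k B)
    then show ?case by (simp add: mip_mult_right mP P mmul_zero_left)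
  next
    case (add Q R)
    then show ?case by (simp add: mip_add_right mP is_mpolyI)
  qed
qed

end

text \<open>The degree bounds make \<open>P n\<close> an eigenfunction up to a remainder
  \<open>R\<close> of degree below \<open>n\<close>. Symmetry moves \<open>D\<close> onto
  \<open>R\<close> without raising its degree, so \<open>R\<close> is orthogonal to itself and
  vanishes.\<close>

lemma W_symmetric_in_DW:
  assumes "matrix_weight I W" "W_symmetric I W D"
  shows "in_DW I W D"
proof -
  interpret matrix_weight I W by fact
  have deg: "\<forall>i<length D. mpoly_deg_le i (D ! i)" and sym:
    "\<And>P Q. is_mpoly P \<Longrightarrow> is_mpoly Q \<Longrightarrow> mip I W (dop_apply D P) Q = mip I W P (dop_apply D Q)"
    using assms(2) by (auto simp: W_symmetric_def)
  have D: "poly_coeff_op D" using deg by (auto simp: poly_coeff_op_def is_mpoly_def)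
  moreover have "\<exists>\<Lambda>. \<forall>n x. dop_apply D (P n) x = \<Lambda> n ** P n x" if OPS: "monic_OPS I W P" for P
  proof -
    have P: "monic_mpoly n (P n)" for n using OPS by (auto simp: monic_OPS_def)
    have mP: "is_mpoly (P n)" for n using P by (rule monic_mpoly_deg_less[THEN is_mpolyI])
    have "\<exists>L. \<forall>x. dop_apply D (P n) x = L ** P n x" for n
    proof -
      have "mpoly_deg_less (Suc n) (dop_apply D (P n))"
        using deg P by (intro mpoly_deg_less_dop_apply monic_mpoly_deg_less)
      then obtain L where L: "mpoly_deg_less n (\<lambda>x. dop_apply D (P n) x - L ** P n x)"
        using monic_mpoly_division[OF P] by blast
      define R where "R = (\<lambda>x. dop_apply D (P n) x - L ** P n x)"
      have R: "mpoly_deg_less n R" using L by (simp add: R_def)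
      then have mR: "is_mpoly R" by (rule is_mpolyI)
      have "mip I W (\<lambda>x. dop_apply D (P n) x + (- L) ** P n x) R = 
          mip I W (P n) (dop_apply D R) + (- L) ** mip I W (P n) R"
        using mP[of n] mR
        by (simp add: mip_add_left mip_mult_left is_mpoly_const_mult is_mpoly_dop_apply[OF D] sym)
      also have "\<dots> = 0"
        by (simp add: monic_OPS_orthogonal[OF OPS] R mpoly_deg_less_dop_apply[OF deg] mmul_zero_right)
      also have "(\<lambda>x. dop_apply D (P n) x + (- L) ** P n x) = R"
        using mmul_diff_left[of 0 L] by (simp add: R_def mmul_zero_left fun_eq_iff)
      finally have "R x = 0" for x by (rule mip_self_eq_0[OF mR])
      then show ?thesis by (auto simp: R_def)
    qed
    then show ?thesis by (intro choice) blast
  qed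
  ultimately show ?thesis unfolding in_DW_def by blast
qed

section \<open>Integrals of odd and even functions over the line\<close>

lemma lborel_integral_odd:
  fixes f :: "real \<Rightarrow> 'a::{banach, second_countable_topology}"
  assumes "\<And>x. f (- x) = - f x"
  shows "integral\<^sup>L lborel f = 0"
proof -
  have "integral\<^sup>L lborel f = integral\<^sup>L lborel (\<lambda>x. f (- x))"
    by (subst lborel_integral_real_affine[where c = "-1" and t = 0]) auto
  also have "\<dots> = - integral\<^sup>L lborel f" by (simp add: assms)
  finally have "2 *\<^sub>R integral\<^sup>L lborel f = 0" by (metis add.right_inverse scaleR_2)
  then show ?thesis by simp
qed

text \<open>The point 0 is null and the two half lines contribute equally. The resulting factor 2
  cancels the one half in the derivative of \<open>sqrt\<close>, leaving exactly the factor
  \<open>1 / sqrt y\<close> of the weight \<open>V\<close>.\<close>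

lemma lborel_integral_even_sqrt:
  fixes f :: "real \<Rightarrow> 'a::euclidean_space"
  assumes f: "integrable lborel f" and even: "\<And>x. f (- x) = f x"
  shows "integral\<^sup>L lborel f = (LBINT y:{0<..}. (1 / sqrt y) *\<^sub>R f (sqrt y))"
proof -
  have meas [measurable]: "f \<in> borel_measurable borel"
    using borel_measurable_integrable[OF f] by simp
  have set_int: "set_integrable lborel A f" if "A \<in> sets borel" for A
    using f that unfolding set_integrable_def by (intro integrable_mult_indicator) auto
  have "integral\<^sup>L lborel f = (LBINT x:{..<0} \<union> {0<..}. f x)"
    unfolding set_lebesgue_integral_def
  proof (rule integral_cong_AE)
    show "AE x in lborel. f x = indicator ({..<0} \<union> {0<..}) x *\<^sub>R f x"
      using AE_lborel_singleton[of "0::real"] by eventually_elim (auto split: split_indicator)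
  qed auto
  also have "\<dots> = (LBINT x:{..<0}. f x) + (LBINT x:{0<..}. f x)"
    by (rule set_integral_Un) (auto intro: set_int)
  also have "(LBINT x:{..<0}. f x) = (LBINT x:{0<..}. f x)"
    by (subst set_integral_reflect) (simp add: even greaterThan_def)
  finally have 1: "integral\<^sup>L lborel f = 2 *\<^sub>R (LBINT x:{0<..}. f x)" by (simp add: scaleR_2)
  define g where "g = (\<lambda>y. (1 / (2 * sqrt y)) *\<^sub>R f (sqrt y))"
  have [measurable]: "g \<in> borel_measurable borel" unfolding g_def by measurable
  have "f absolutely_integrable_on {0<..}"
    using set_int[of "{0<..}"] by (simp add: set_integrable_def integrable_completion)
  moreover have "integral {0<..} f = (LBINT x:{0<..}. f x)"
    by (rule set_borel_integral_eq_integral(2)[symmetric, OF set_int]) simp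
  moreover have "sqrt ` {0<..} = {0<..}"
  proof -
    have "x \<in> sqrt ` {0<..}" if "x > 0" for x
      using that by (intro image_eqI[of _ _ "x\<^sup>2"]) auto
    then show ?thesis by auto
  qed
  \<comment> \<open>Change of variables speaks of absolute integrability over the Lebesgue
    completion; measurability of \<open>f\<close> and \<open>g\<close> permits the passage to and
    from \<open>lborel\<close>.\<close>
  moreover have "(\<lambda>x. \<bar>1 / (2 * sqrt x)\<bar> *\<^sub>R f (sqrt x)) absolutely_integrable_on {0<..} \<and>
     integral {0<..} (\<lambda>x. \<bar>1 / (2 * sqrt x)\<bar> *\<^sub>R f (sqrt x)) = b
     \<longleftrightarrow> f absolutely_integrable_on sqrt ` {0<..} \<and> integral (sqrt ` {0<..}) f = b" for b
    by (rule has_absolute_integral_change_of_variables_real)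
      (auto intro!: derivative_eq_intros simp: inj_on_def divide_simps)
  ultimately have "(\<lambda>x. \<bar>1 / (2 * sqrt x)\<bar> *\<^sub>R f (sqrt x)) absolutely_integrable_on {0<..} \<and>
     integral {0<..} (\<lambda>x. \<bar>1 / (2 * sqrt x)\<bar> *\<^sub>R f (sqrt x)) = (LBINT x:{0<..}. f x)"
    by simp
  moreover have "(\<lambda>x. \<bar>1 / (2 * sqrt x)\<bar> *\<^sub>R f (sqrt x)) absolutely_integrable_on {0<..} \<longleftrightarrow> 
      g absolutely_integrable_on {0<..}"
    by (rule set_integrable_cong) (auto simp: g_def)
  moreover have "integral {0<..} (\<lambda>x. \<bar>1 / (2 * sqrt x)\<bar> *\<^sub>R f (sqrt x)) = integral {0<..} g"
    by (rule Henstock_Kurzweil_Integration.integral_cong) (auto simp: g_def)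
  ultimately have "g absolutely_integrable_on {0<..}" "integral {0<..} g = (LBINT x:{0<..}. f x)" by auto
  moreover from this(1) have "set_integrable lborel {0<..} g"
    by (simp add: set_integrable_def integrable_completion)
  ultimately have "(LBINT x:{0<..}. f x) = (LBINT y:{0<..}. g y)"
    by (simp add: set_borel_integral_eq_integral(2))
  also have "2 *\<^sub>R \<dots> = (LBINT y:{0<..}. 2 *\<^sub>R g y)" by simp
  finally show ?thesis by (simp add: 1 g_def)
qed

section \<open>Even weights\<close>

lemma Ioi_not_null_set: "{0<..} \<notin> null_sets (lborel :: real measure)"
proof
  assume "{0<..} \<in> null_sets (lborel :: real measure)"
  then have "{0<..<1} \<in> null_sets (lborel :: real measure)"
    by (rule null_sets_subset) auto
  then show False by auto
qed

lemma weight_matrix_imp_matrix_weight: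
  assumes "weight_matrix I W" "I \<in> sets lborel" "I \<notin> null_sets lborel"
  shows "matrix_weight I W"
  using assms by unfold_locales (auto simp: weight_matrix_def)

lemma pos_def_mat_scaleR:
  fixes A :: "complex^'n^'n"
  assumes "pos_def_mat A" "c > 0"
  shows "pos_def_mat (c *\<^sub>R A)"
proof -
  have "Re (\<Sum>i\<in>UNIV. cnj (v $ i) * ((c *\<^sub>R A) *v v) $ i) = c * Re (\<Sum>i\<in>UNIV. cnj (v $ i) * (A *v v) $ i)" for v :: "complex^'n"
    by (simp add: sum_distrib_left matrix_vector_mult_def scaleR_sum_right[symmetric] algebra_simps)
  then show ?thesis using assms
    by (simp add: pos_def_mat_def linear_scale[OF linear_madj])
qed

text \<open>The moments shift by one and positivity of \<open>y\<close> preserves definiteness. This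
  is the weight seen by odd polynomials.\<close>

lemma matrix_weight_times_id:
  assumes "matrix_weight {0<..} V"
  shows "matrix_weight {0<..} (\<lambda>y. y *\<^sub>R V y)"
proof -
  interpret matrix_weight "{0<..}" V by fact
  show ?thesis
  proof
    show "set_integrable lborel {0<..} (\<lambda>x. complex_of_real (x ^ n) * (x *\<^sub>R V x) $ i $ j)" for n i j
      using moments[of "Suc n" i j] by (simp add: scaleR_conv_of_real[where 'a = complex] mult_ac)
    show "AE x in lborel. x \<in> {0<..} \<longrightarrow> pos_def_mat (x *\<^sub>R V x)"
      using pos_def by eventually_elim (auto intro: pos_def_mat_scaleR)
  qed (rule I_sets I_nonnull)+
qed

lemma monic_mpoly_compose_square:
  assumes "monic_mpoly n P"
  shows "monic_mpoly (2 * n) (\<lambda>x. P (x\<^sup>2))"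
proof -
  obtain A where A: "A n = mat 1" "\<And>x. P x = (\<Sum>i<Suc n. x ^ i *\<^sub>R A i)"
    using assms by (auto simp: monic_mpoly_iff)
  define C where "C = (\<lambda>i. if even i then A (i div 2) else 0)"
  have "P (x\<^sup>2) = (\<Sum>i<2 * Suc n. x ^ i *\<^sub>R C i)" for x
    by (subst sum_lessThan_double) (simp_all add: C_def A power_mult)
  then have "P (x\<^sup>2) = (\<Sum>i<Suc (2 * n). x ^ i *\<^sub>R C i)" for x
    by (simp add: C_def)
  then show ?thesis unfolding monic_mpoly_iff
    by (intro exI[of _ C]) (simp add: C_def A(1))
qed

lemma monic_mpoly_times_id:
  assumes "monic_mpoly n P"
  shows "monic_mpoly (Suc n) (\<lambda>x. x *\<^sub>R P x)"
proof -
  obtain A where A: "A n = mat 1" "\<And>x. P x = (\<Sum>i<Suc n. x ^ i *\<^sub>R A i)"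
    using assms by (auto simp: monic_mpoly_iff)
  have "x *\<^sub>R P x = (\<Sum>i<Suc (Suc n). x ^ i *\<^sub>R (case i of 0 \<Rightarrow> 0 | Suc j \<Rightarrow> A j))" for x
    by (subst sum.lessThan_Suc_shift) (simp add: A scaleR_sum_right scaleR_add_right del: sum.lessThan_Suc)
  then show ?thesis unfolding monic_mpoly_iff
    by (intro exI[of _ "case_nat 0 A"]) (simp add: A(1))
qed

lemma mip_odd_even:
  fixes W :: "real \<Rightarrow> complex^'n^'n"
  assumes "\<And>x. W (- x) = W x" "\<And>x. P (- x) = c *\<^sub>R P x" "\<And>x. Q (- x) = d *\<^sub>R Q x" "c * d = -1"
  shows "mip UNIV W P Q = 0"
proof -
  have "P (- x) ** W (- x) ** madj (Q (- x)) = (c * d) *\<^sub>R (P x ** W x ** madj (Q x))" for x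
    by (simp add: assms(1-3) linear_scale[OF linear_madj] mmul_scaleR_left mmul_scaleR_right)
  then show ?thesis
    by (simp add: mip_def vec_eq_iff set_lebesgue_integral_def assms(4) lborel_integral_odd)
qed

text \<open>Both parities are treated at once: \<open>p\<close>, \<open>V\<close> and
  \<open>q\<close> are kept free, so that two odd factors \<open>sqrt y\<close> can be absorbed into
  the weight.\<close>

lemma mip_even:
  fixes W :: "real \<Rightarrow> complex^'n^'n"
  assumes W: "matrix_weight UNIV W" "\<And>x. W (- x) = W x" 
    and P: "is_mpoly P" "\<And>x. P (- x) = c *\<^sub>R P x"
    and Q: "is_mpoly Q" "\<And>x. Q (- x) = d *\<^sub>R Q x" and "c * d = 1"
    and eq: "\<And>y. y > 0 \<Longrightarrow> (1 / sqrt y) *\<^sub>R (P (sqrt y) ** W (sqrt y) ** madj (Q (sqrt y))) = p y ** V y ** madj (q y)"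
  shows "mip UNIV W P Q = mip {0<..} V p q"
proof -
  interpret matrix_weight UNIV W by fact
  have even: "P (- x) ** W (- x) ** madj (Q (- x)) = P x ** W x ** madj (Q x)" for x
    using \<open>c * d = 1\<close> by (simp add: W P Q linear_scale[OF linear_madj] mmul_scaleR_left mmul_scaleR_right mult.commute)
  have "(LBINT x:UNIV. (P x ** W x ** madj (Q x)) $ i $ j) = (LBINT y:{0<..}. (p y ** V y ** madj (q y)) $ i $ j)" for i j
  proof -
    have "(LBINT x:UNIV. (P x ** W x ** madj (Q x)) $ i $ j) =
        (LBINT y:{0<..}. (1 / sqrt y) *\<^sub>R (P (sqrt y) ** W (sqrt y) ** madj (Q (sqrt y))) $ i $ j)"
      using lborel_integral_even_sqrt[of "\<lambda>x. (P x ** W x ** madj (Q x)) $ i $ j"]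
        integrable_mip[OF P(1) Q(1), of i j]
      by (simp add: even set_integrable_def set_lebesgue_integral_def)
    also have "\<dots> = (LBINT y:{0<..}. ((1 / sqrt y) *\<^sub>R (P (sqrt y) ** W (sqrt y) ** madj (Q (sqrt y)))) $ i $ j)"
      by simp
    also have "\<dots> = (LBINT y:{0<..}. (p y ** V y ** madj (q y)) $ i $ j)"
      by (rule set_lebesgue_integral_cong) (auto simp: eq)
    finally show ?thesis .
  qed
  then show ?thesis by (simp add: mip_def)
qed

section \<open>Transfer from an even weight to the half line\<close>

locale even_weight =
  fixes W V :: "real \<Rightarrow> complex^'n^'n"
  assumes weight_W: "matrix_weight UNIV W"
    and weight_V: "matrix_weight {0<..} V"
    and W_even: "W (- x) = W x"
    and V_eq: "y > 0 \<Longrightarrow> V y = (1 / sqrt y) *\<^sub>R W (sqrt y)"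
begin

lemma mip_compose_square:
  assumes "is_mpoly P" "is_mpoly Q"
  shows "mip UNIV W (\<lambda>x. P (x\<^sup>2)) (\<lambda>x. Q (x\<^sup>2)) = mip {0<..} V P Q"
  by (rule mip_even[OF weight_W W_even, where c = 1 and d = 1])
    (simp_all add: assms is_mpoly_compose_square V_eq mmul_scaleR_left mmul_scaleR_right)

lemma mip_times_id_compose_square:
  assumes "is_mpoly P" "is_mpoly Q"
  shows "mip UNIV W (\<lambda>x. x *\<^sub>R P (x\<^sup>2)) (\<lambda>x. x *\<^sub>R Q (x\<^sup>2)) = mip {0<..} (\<lambda>y. y *\<^sub>R V y) P Q"
proof (rule mip_even[OF weight_W W_even, where c = "-1" and d = "-1"])
  show "is_mpoly (\<lambda>x. x *\<^sub>R P (x\<^sup>2))" "is_mpoly (\<lambda>x. x *\<^sub>R Q (x\<^sup>2))"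
    using is_mpoly_power_scaleR[OF is_mpoly_compose_square, of _ 1] assms by auto
qed (auto simp: V_eq mmul_scaleR_left mmul_scaleR_right linear_scale[OF linear_madj])

definition interleave ::
    "(nat \<Rightarrow> real \<Rightarrow> complex^'n^'n) \<Rightarrow> (nat \<Rightarrow> real \<Rightarrow> complex^'n^'n) \<Rightarrow> nat \<Rightarrow> real \<Rightarrow> complex^'n^'n" where
  "interleave P S n x = (if even n then P (n div 2) (x\<^sup>2) else x *\<^sub>R S (n div 2) (x\<^sup>2))"

lemma interleave_parity: "interleave P S n (- x) = (-1) ^ n *\<^sub>R interleave P S n x"
  by (simp add: interleave_def)

lemma monic_OPS_interleave:
  assumes P: "monic_OPS {0<..} V P" and S: "monic_OPS {0<..} (\<lambda>y. y *\<^sub>R V y) S"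
  shows "monic_OPS UNIV W (interleave P S)"
proof -
  have monic: "monic_mpoly n (P n)" "monic_mpoly n (S n)" for n
    using P S by (auto simp: monic_OPS_def)
  then have mpoly: "is_mpoly (P n)" "is_mpoly (S n)" for n
    by (auto intro: is_mpolyI monic_mpoly_deg_less)
  have ev: "interleave P S (2 * k) = (\<lambda>x. P k (x\<^sup>2))" for k
    by (simp add: interleave_def fun_eq_iff)
  have od: "interleave P S (Suc (2 * k)) = (\<lambda>x. x *\<^sub>R S k (x\<^sup>2))" for k
    by (simp add: interleave_def fun_eq_iff)
  have "monic_mpoly n (interleave P S n)" for n
  proof (cases "even n")
    case True
    then obtain k where "n = 2 * k" by (elim evenE)
    then show ?thesis using monic_mpoly_compose_square[OF monic(1)] by (simp add: ev)
  next
    case False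
    then obtain k where "n = Suc (2 * k)" by (elim oddE) simp
    then show ?thesis using monic_mpoly_times_id[OF monic_mpoly_compose_square[OF monic(2)]] by (simp add: od)
  qed
  moreover have "mip UNIV W (interleave P S m) (interleave P S n) = 0" if "m \<noteq> n" for m n
  proof (cases "even (m + n)")
    case False
    then show ?thesis
      by (intro mip_odd_even[where c = "(-1) ^ m" and d = "(-1) ^ n"] W_even interleave_parity)
        (simp flip: power_add)
  next
    case True
    show ?thesis
    proof (cases "even m")
      case m: True
      then obtain k l where "m = 2 * k" "n = 2 * l" using True by (auto elim!: evenE)
      then show ?thesis using that P
        by (simp add: ev mip_compose_square mpoly monic_OPS_def)
    next
      case False
      then obtain k l where "m = Suc (2 * k)" "n = Suc (2 * l)" using True by (auto elim!: oddE)
      then show ?thesis using that S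
        by (simp add: od mip_times_id_compose_square mpoly monic_OPS_def)
    qed
  qed
  ultimately show ?thesis by (auto simp: monic_OPS_def)
qed

text \<open>\<open>D\<close> commutes with the reflection \<open>x \<mapsto> -x\<close> on each member of an orthogonal sequence
  of definite parity, hence on all polynomials, in particular on powers of \<open>x - a\<close>.\<close>

lemma in_DW_parity:
  assumes D: "in_DW UNIV W D" and "k < length D"
  shows "(D ! k) (- a) = (-1) ^ k *\<^sub>R (D ! k) a"
proof -
  obtain P where P: "monic_OPS {0<..} V P"
    using matrix_weight.monic_OPS_exists[OF weight_V] .
  obtain S where S: "monic_OPS {0<..} (\<lambda>y. y *\<^sub>R V y) S"
    using matrix_weight.monic_OPS_exists[OF matrix_weight_times_id[OF weight_V]] .
  define R where "R = interleave P S"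
  have OPS: "monic_OPS UNIV W R" unfolding R_def using P S by (rule monic_OPS_interleave)
  then obtain \<Lambda> where \<Lambda>: "\<And>n x. dop_apply D (R n) x = \<Lambda> n ** R n x"
    using D by (auto simp: in_DW_def)
  have R: "monic_mpoly n (R n)" for n using OPS by (auto simp: monic_OPS_def)
  have mR: "is_mpoly (R n)" for n using R by (rule monic_mpoly_deg_less[THEN is_mpolyI])
  have R_parity: "R n (- x) = (-1) ^ n *\<^sub>R R n x" for n x
    unfolding R_def by (rule interleave_parity)
  have reflect: "dop_apply D (\<lambda>x. Q (- x)) = (\<lambda>x. dop_apply D Q (- x))" if "mpoly_deg_less n Q" for n Q
    using R that
  proof (induction rule: mpoly_induct_monic)
    case zero
    then show ?case by (simp add: dop_apply_zero)
  next
    case (basis k B)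
    have "dop_apply D (\<lambda>x. B ** R k (- x)) = dop_apply D (\<lambda>x. (-1) ^ k *\<^sub>R (B ** R k x))"
      by (simp add: R_parity mmul_scaleR_right)
    also have "\<dots> = (\<lambda>x. (-1) ^ k *\<^sub>R (B ** (\<Lambda> k ** R k x)))"
      using mR[of k] by (simp add: dop_apply_scaleR dop_apply_mult is_mpoly_smooth is_mpoly_const_mult \<Lambda>)
    also have "\<dots> = (\<lambda>x. dop_apply D (\<lambda>x. B ** R k x) (- x))"
      using mR[of k] by (simp add: dop_apply_mult is_mpoly_smooth \<Lambda> R_parity mmul_scaleR_right)
    finally show ?case .
  next
    case (add Q Q')
    from add(1,2) have "is_mpoly Q" "is_mpoly Q'" by (auto intro: is_mpolyI)
    then show ?case using add(3,4)
      by (simp add: dop_apply_add is_mpoly_smooth is_mpoly_compose_minus)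
  qed
  \<comment> \<open>\<open>reflect\<close> asks for a degree bound in powers of \<open>x\<close>,
    hence the binomial expansion about 0.\<close>
  have power: "mpoly_deg_less (Suc m) (\<lambda>x. (x - b) ^ m *\<^sub>R mat 1)" for b :: real and m
  proof -
    have binom: "(x - b) ^ m = (\<Sum>i\<le>m. of_nat (m choose i) * x ^ i * (- b) ^ (m - i))" for x
      using binomial_ring[of x "- b" m] by simp
    have "mpoly_deg_less (Suc m) (\<lambda>x. \<Sum>i\<le>m. (of_nat (m choose i) * (- b) ^ (m - i)) *\<^sub>R x ^ i *\<^sub>R mat 1)"
      by (intro mpoly_deg_less_sum mpoly_deg_less_scaleR mpoly_deg_less_mono[OF mpoly_deg_less_monomial]) auto
    then show ?thesis
      by (simp add: binom scaleR_sum_left mult_ac)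
  qed
  \<comment> \<open>Both ends evaluate a power at its root: at \<open>a\<close> this isolates the
    coefficient of order \<open>k\<close>, and after reflection the same happens at
    \<open>- a\<close>, with the sign taken out of \<open>(- x - a) ^ k\<close>.\<close>
  have "fact k *\<^sub>R (D ! k) a = dop_apply D (\<lambda>x. (x - a) ^ k *\<^sub>R mat 1) a"
    using dop_apply_power_at_root[OF assms(2), of a "mat 1"] by simp
  also have "\<dots> = dop_apply D (\<lambda>x. (- x - a) ^ k *\<^sub>R mat 1) (- a)"
    by (simp add: reflect[OF power[of k a]])
  also have "(\<lambda>x. (- x - a) ^ k *\<^sub>R (mat 1 :: complex^'n^'n)) = (\<lambda>x. (x - (- a)) ^ k *\<^sub>R ((-1) ^ k *\<^sub>R mat 1))"
    using power_minus[of "_ + a" k] by (simp add: fun_eq_iff mult.commute)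
  also have "dop_apply D \<dots> (- a) = fact k *\<^sub>R ((-1) ^ k *\<^sub>R (D ! k) (- a))"
    by (subst dop_apply_power_at_root[OF assms(2)]) (simp add: mmul_scaleR_left)
  finally have "(D ! k) a = (-1) ^ k *\<^sub>R (D ! k) (- a)" by (simp only: scaleR_cancel_left fact_nonzero) simp
  then have "(-1) ^ k *\<^sub>R (D ! k) a = ((-1) ^ k * (-1) ^ k) *\<^sub>R (D ! k) (- a)" by simp
  then show ?thesis by (simp flip: power_mult_distrib)
qed

lemma in_DW_tilde_op_exists:
  assumes "in_DW UNIV W D"
  shows "\<exists>Dt. poly_coeff_op Dt \<and> tilde_op D Dt"
  using assms by (intro tilde_op_exists in_DW_parity) (auto simp: in_DW_def)

lemma in_DW_tilde:
  assumes D: "in_DW UNIV W D" and Dt: "poly_coeff_op Dt" "tilde_op D Dt"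
  shows "in_DW {0<..} V Dt"
  unfolding in_DW_def
proof (intro conjI allI impI)
  fix P assume P: "monic_OPS {0<..} V P"
  \<comment> \<open>\<open>P\<close> is arbitrary; any sequence \<open>S\<close> for the second
    weight completes it to one for \<open>W\<close>, in which \<open>P n\<close> sits at index
    \<open>2 * n\<close> and takes its eigenvalue from there.\<close>
  obtain S where S: "monic_OPS {0<..} (\<lambda>y. y *\<^sub>R V y) S"
    using matrix_weight.monic_OPS_exists[OF matrix_weight_times_id[OF weight_V]] .
  obtain \<Lambda> where \<Lambda>: "\<And>n x. dop_apply D (interleave P S n) x = \<Lambda> n ** interleave P S n x"
    using D monic_OPS_interleave[OF P S] by (auto simp: in_DW_def)
  have P_sq: "(\<lambda>x. P n (x\<^sup>2)) = interleave P S (2 * n)" for n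
    by (simp add: interleave_def fun_eq_iff)
  have mP: "is_mpoly (P n)" for n
    using P by (auto simp: monic_OPS_def intro: is_mpolyI monic_mpoly_deg_less)
  have "dop_apply Dt (P n) y = \<Lambda> (2 * n) ** P n y" for n y
  proof (rule mpoly_eqI)
    show "is_mpoly (dop_apply Dt (P n))" using Dt(1) mP by (rule is_mpoly_dop_apply)
    show "is_mpoly (\<lambda>y. \<Lambda> (2 * n) ** P n y)" using mP by (rule is_mpoly_const_mult)
    show "dop_apply Dt (P n) y = \<Lambda> (2 * n) ** P n y" if "y > 0" for y
      using that tilde_op_apply[OF Dt(2) mP that, of n]
      by (simp add: P_sq \<Lambda>) (simp add: interleave_def)
  qed
  then show "\<exists>\<Lambda>. \<forall>n x. dop_apply Dt (P n) x = \<Lambda> n ** P n x"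
    by (intro exI[of _ "\<lambda>n. \<Lambda> (2 * n)"]) simp
qed (rule Dt(1))

lemma W_symmetric_tilde:
  assumes D: "W_symmetric UNIV W D" and Dt: "poly_coeff_op Dt" "tilde_op D Dt"
  shows "W_symmetric {0<..} V Dt"
proof -
  have deg: "\<forall>i<length D. mpoly_deg_le i (D ! i)"
    and sym: "\<And>P Q. is_mpoly P \<Longrightarrow> is_mpoly Q \<Longrightarrow> mip UNIV W (dop_apply D P) Q = mip UNIV W P (dop_apply D Q)"
    using D by (auto simp: W_symmetric_def)
  have D_poly: "poly_coeff_op D" using deg by (auto simp: poly_coeff_op_def is_mpoly_def)
  note square = tilde_op_apply_square[OF Dt(2) D_poly Dt(1)]
  \<comment> \<open>The monomial of degree \<open>k\<close> in \<open>y\<close> has degree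
    \<open>2 * k\<close> in \<open>x\<close>, a bound kept by \<open>D\<close>; since the result is
    a polynomial in the square, the bound halves.\<close>
  have "mpoly_deg_less (Suc k) (dop_apply Dt (\<lambda>y. y ^ k *\<^sub>R mat 1))" for k
  proof (rule mpoly_deg_less_of_square)
    show "is_mpoly (dop_apply Dt (\<lambda>y. y ^ k *\<^sub>R mat 1))"
      using Dt(1) is_mpoly_monomial by (rule is_mpoly_dop_apply)
    show "mpoly_deg_less (Suc (2 * k)) (dop_apply D (\<lambda>x. (x\<^sup>2) ^ k *\<^sub>R mat 1))"
      using deg mpoly_deg_less_compose_square[OF mpoly_deg_less_monomial] by (rule mpoly_deg_less_dop_apply)
  qed (rule square[OF is_mpoly_monomial])
  then have "\<forall>i<length Dt. mpoly_deg_le i (Dt ! i)"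
    by (simp add: mpoly_deg_le_iff coeff_degree_of_degree_preserving)
  moreover have "mip {0<..} V (dop_apply Dt P) Q = mip {0<..} V P (dop_apply Dt Q)"
    if PQ: "is_mpoly P" "is_mpoly Q" for P Q
  proof -
    have "mip {0<..} V (dop_apply Dt P) Q = mip UNIV W (dop_apply D (\<lambda>x. P (x\<^sup>2))) (\<lambda>x. Q (x\<^sup>2))"
      using mip_compose_square[OF is_mpoly_dop_apply[OF Dt(1) PQ(1)] PQ(2)] by (simp add: square PQ)
    also have "\<dots> = mip UNIV W (\<lambda>x. P (x\<^sup>2)) (dop_apply D (\<lambda>x. Q (x\<^sup>2)))"
      by (intro sym is_mpoly_compose_square PQ)
    also have "\<dots> = mip {0<..} V P (dop_apply Dt Q)"
      using mip_compose_square[OF PQ(1) is_mpoly_dop_apply[OF Dt(1) PQ(2)]] by (simp add: square PQ)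
    finally show ?thesis .
  qed
  ultimately show ?thesis by (auto simp: W_symmetric_def)
qed

end

theorem theorem4p2:
  fixes W Z V :: "real \<Rightarrow> complex^'n^'n"
  assumes "weight_matrix UNIV W"
    and "\<forall>x. W x = exp (- (x ^ 2)) *\<^sub>R Z x"
    and "\<forall>x. W (- x) = W x"
    and "\<forall>y>0. V y = (1 / sqrt y) *\<^sub>R W (sqrt y)"
    and "weight_matrix {0<..} V"
  shows "(\<forall>D. in_DW UNIV W D \<longrightarrow>
            (\<exists>Dt. poly_coeff_op Dt \<and> tilde_op D Dt) \<and>
            (\<forall>Dt. poly_coeff_op Dt \<and> tilde_op D Dt \<longrightarrow> in_DW {0<..} V Dt))
       \<and> (\<forall>D. W_symmetric UNIV W D \<longrightarrow>
            (\<exists>Dt. poly_coeff_op Dt \<and> tilde_op D Dt) \<and>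
            (\<forall>Dt. poly_coeff_op Dt \<and> tilde_op D Dt \<longrightarrow> W_symmetric {0<..} V Dt))"
proof -
  have weight_W: "matrix_weight UNIV W"
    using assms(1) by (rule weight_matrix_imp_matrix_weight) (auto simp: null_sets_def)
  have weight_V: "matrix_weight {0<..} V"
    using assms(5) by (rule weight_matrix_imp_matrix_weight) (simp_all add: Ioi_not_null_set)
  interpret even_weight W V
    using weight_W weight_V assms(3,4) by (intro even_weight.intro) blast+
  \<comment> \<open>Symmetric operators obtain their polynomial \<open>Dt\<close> through membership
    in the algebra.\<close>
  show ?thesis
    using in_DW_tilde_op_exists in_DW_tilde W_symmetric_tilde W_symmetric_in_DW[OF weight_W] by blast
qed

end
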